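(* Consider the SWIFT iteration described in the context, with client-communication vectors $w_i^t$ produced by the Communication Coefficient Selection (CCS) procedure described in the context, and under the standing assumptions listed there. Then the product of the differences between the actual and expected client-communication matrices is bounded as follows, for a client $i$ and iteration $t$: $$\mathbb{E}\sum_{j=0}^{t}\Big\|G(x_{i_j}^j,\xi_{i_j}^j)\prod_{q=j+1}^{t}\big(W_{i_q}^q-\bar{W}^q\big)\Big(\frac{\mathbf{1}_n}{n}-\mathbf{e}_i\Big)\Big\|^2=\mathcal{O}\Big(\frac{\sigma^2}{M}+\mathbb{E}\sum_{j=0}^{t}\|\nabla f_{i_j}(x_{i_j}^j)\|^2\Big).$$
   Context: **Problem.** There are $n\ge2$ clients, the vertices of a communication graph $\mathcal{G}$. Client $i$ has a data distribution $\mathcal{D}_i$. With a loss $\ell(x;\xi)$, $x\in\mathbb{R}^d$, set $f_i(x)=\mathbb{E}_{\xi\sim\mathcal{D}_i}[\ell(x;\xi)]$ and $f=\sum_i p_if_i$, where $p_i\ge0$, $\sum_ip_i=1$. $\nabla\ell$ is the gradient in $x$ and norms are Euclidean. **Standing assumptions.** $f$ and all $f_i$ have $L$-Lipschitz gradients; $\mathbb{E}_{\xi\sim\mathcal{D}_i}[\nabla\ell(x;\xi)]=\nabla f_i(x)$ for all $i,x$; and there are constants $\sigma,\zeta\ge0$ with $\sum_i p_i\|\nabla f(x)-\nabla f_i(x)\|^2\le\zeta^2$ for all $x$ and $\mathbb{E}_{\xi\sim\mathcal{D}_i}\|\nabla f_i(x)-\nabla\ell(x;\xi)\|^2\le\sigma^2$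 for all $i,x$. The communication graph is uniformly strongly connected: there is an integer $B>0$ such that the union of the communication graphs over any $B$ consecutive iterations is strongly connected. **Communication weights.** At iteration $t$ client $i$ has a communication vector $w_i^t=[w_{1,i}^t,\dots,w_{n,i}^t]^\top\in\mathbb{R}^n$, with $w_{j,i}^t=0$ for $j\neq i$ unless $j$ is a neighbor of $i$ in $\mathcal{G}$. These vectors are computed by the CCS procedure below before the iteration starts, and are recomputed by CCS on the current graph whenever the network topology changes; otherwise they stay fixed. Let $\mathbf{e}_i$ be the $i$-th standard basis vector, $I_n$ the identity and $\mathbf{1}_n$ the all-ones vector. The expected communication matrix is $\bar{W}^t:=I_n+\sum_{i=1}^n p_i(w_i^t-\mathbf{e}_i)\mathbf{e}_i^\top$. **CCS procedure.** Let $d_i$ be the degree of client $i$ and $J_i$ its set of one-hop neighbors. Let $J_i^{L}$, $J_i^{SE}$, $J_i^{E}$ be the sets of neighbors of $i$ with degree larger than, no larger than, and equal to $d_i$, respectively. All clients run the following in parallel; client $i$ does: 1. Initialize $w_i=\frac1n\mathbf{e}_i$ if the scores $p_1,\dots,p_n$ are not all equal, and $w_i=\mathbf{0}$ if they are all equal. 2. For each $j\in J_i^{L}$, wait until $j$ has sent the coefficient $w_{j,i}$ and store it. 3. Set $s_w^i=\sum_{m=1}^n w_{m,i}$. 4. If $J_i^{SE}\ne\emptyset$: set $s_p^i=\sum_{j\in J_i^{SE}\cup\{i\}}p_j$. If moreover $J_i^{E}\neq\emptyset$: exchange $s_w^i,s_p^i$ with every $j\in J_i^{E}$; for each $j\in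 J_i^{E}$ put $s_w^*=\max\{s_w^i,s_w^j\}$, $s_p^*=\max\{s_p^i,s_p^j\}$ and set $w_{j,i}=(1-s_w^* )p_j/s_p^*$; then recompute $s_w^i=\sum_{m=1}^n w_{m,i}$ and $s_p^i=\sum_{j\in(J_i^{SE}\cup\{i\})\setminus J_i^{E}}p_j$. Next (whether or not $J_i^{E}$ is empty), for every $j\in(J_i^{SE}\cup\{i\})\setminus J_i^{E}$ replace $w_{j,i}$ by $w_{j,i}+(1-s_w^i)p_j/s_p^i$, and send the coefficient $w_{i,j}=(1-s_w^i)p_i/s_p^i$ to every $j\in J_i^{SE}\setminus J_i^{E}$. 5. If $J_i^{SE}=\emptyset$: replace $w_{i,i}$ by $w_{i,i}+1-s_w^i$. The procedure is designed so that $\sum_j w_{j,i}=1$, $w_{i,i}\ge1/n$ and $p_jw_{i,j}=p_iw_{j,i}$ for all $i,j$, so that $\bar W^t$ is symmetric and doubly stochastic. **SWIFT iteration.** All clients start from the same model $x_i^0=x^0$. Each client has a local counter $c_i$, initially $1$. The communication set is $\mathcal{C}_s=\{t\in\mathbb{N}: t\bmod(s+1)=0,\ t\le T\}$ for a fixed integer $s\ge0$, where $T$ is the total number of iterations. At each iteration $t=0,1,2,\dots$: an active client $i_t$ is drawn with probabilities $(p_1,\dots,p_n)$; a mini-batch $\xi_{i_t}^t=\{\xi_{i_t,m}^t\}_{m=1}^M$ of $M$ samples from $\mathcal{D}_{i_t}$ is drawn, and $g(x_{i_t}^t,\xi_{i_t}^t)=\frac1M\sum_{m=1}^M\nabla\ell(x_{i_t}^t;\xi_{i_t,m}^t)$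 (draws of clients and samples are independent); with $X^t=[x_1^t,\dots,x_n^t]\in\mathbb{R}^{d\times n}$ the update is $X^{t+1}=X^tW_{i_t}^t-\gamma\,G(x_{i_t}^t,\xi_{i_t}^t)$ with step size $\gamma>0$, where $G(x_{i_t}^t,\xi_{i_t}^t)\in\mathbb{R}^{d\times n}$ has $i_t$-th column $g(x_{i_t}^t,\xi_{i_t}^t)$ and all other columns zero, and $W_{i_t}^t=I_n+(w_{i_t}^t-\mathbf{e}_{i_t})\mathbf{e}_{i_t}^\top$ if $c_{i_t}\in\mathcal{C}_s$, $W_{i_t}^t=I_n$ otherwise; then $c_{i_t}$ is increased by $1$. $\mathbb{E}$ is expectation over all randomness (active clients and data). Matrix products $\prod_{q=j+1}^t$ are taken in increasing order of $q$ from left to right, and an empty product is $I_n$.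
   Formalization: The properties CCS is designed to give (each w_i sums to 1, w_{i,i} ≥ 1/n, p_j w_{i,j} = p_i w_{j,i}, expected matrix symmetric and doubly stochastic) are assumed: on some graphs or with zero scores CCS as described violates them, and the bound can then fail. *)

theory Defs
  imports "HOL-Probability.Probability"
begin

section \<open>Communication graphs\<close>

text \<open>Clients are the elements of a finite type, and a communication graph is a symmetric
  irreflexive relation on it.\<close>

definition nbrs :: "('n \<times> 'n) set \<Rightarrow> 'n \<Rightarrow> 'n set" where
  "nbrs E i = {j. (i, j) \<in> E}"

definition deg :: "('n \<times> 'n) set \<Rightarrow> 'n \<Rightarrow> nat" where
  "deg E i = card (nbrs E i)"

definition J_L :: "('n \<times> 'n) set \<Rightarrow> 'n \<Rightarrow> 'n set" where
  "J_L E i = {j \<in> nbrs E i. deg E j > deg E i}"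

definition J_SE :: "('n \<times> 'n) set \<Rightarrow> 'n \<Rightarrow> 'n set" where
  "J_SE E i = {j \<in> nbrs E i. deg E j \<le> deg E i}"

definition J_E :: "('n \<times> 'n) set \<Rightarrow> 'n \<Rightarrow> 'n set" where
  "J_E E i = {j \<in> nbrs E i. deg E j = deg E i}"

definition uniformly_strongly_connected :: "nat \<Rightarrow> (nat \<Rightarrow> ('n \<times> 'n) set) \<Rightarrow> bool" where
  "uniformly_strongly_connected B E \<longleftrightarrow>
     B > 0 \<and> (\<forall>t u v. (u, v) \<in> (\<Union>\<tau>\<in>{t..<t + B}. E \<tau>)\<^sup>*)"

section \<open>Communication Coefficient Selection\<close>

definition ccs_init :: "('n::finite \<Rightarrow> real) \<Rightarrow> real" where
  "ccs_init p = (if \<forall>i j. p i = p j then 0 else 1 / real CARD('n))"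

definition ccs_sp :: "('n::finite \<Rightarrow> real) \<Rightarrow> ('n \<times> 'n) set \<Rightarrow> 'n \<Rightarrow> real" where
  "ccs_sp p E i = (\<Sum>j\<in>J_SE E i \<union> {i}. p j)"

definition ccs_sp' :: "('n::finite \<Rightarrow> real) \<Rightarrow> ('n \<times> 'n) set \<Rightarrow> 'n \<Rightarrow> real" where
  "ccs_sp' p E i = (\<Sum>j\<in>(J_SE E i \<union> {i}) - J_E E i. p j)"

lemma deg_le_card: "deg E (i::'n::finite) \<le> CARD('n)"
  by (simp add: deg_def card_mono)

text \<open>The procedure is determined by recursion along decreasing degree.
  \<^item> \<open>ccs_sw p E i\<close> is the sum \<open>s_w\<close> that client \<open>i\<close> holds once all neighbours of larger degree
    have sent their coefficients.
  \<^item> \<open>ccs_eq p E i j\<close> is the entry \<open>w_{j,i}\<close> agreed with a neighbour \<open>j\<close> of equal degree.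
  \<^item> \<open>ccs_sw' p E i\<close> is the sum \<open>s_w\<close> recomputed after the exchange with the neighbours of
    equal degree.
  \<^item> \<open>ccs_send p E i\<close> is the coefficient \<open>w_{i,j}\<close> that \<open>i\<close> sends to its neighbours \<open>j\<close> of
    smaller degree; it does not depend on \<open>j\<close>.

  If client \<open>i\<close> has no neighbour of equal degree, the recomputed sums agree with the original
  ones, so the two branches of the procedure need not be distinguished.\<close>

function ccs_sw :: "('n::finite \<Rightarrow> real) \<Rightarrow> ('n \<times> 'n) set \<Rightarrow> 'n \<Rightarrow> real"
  and ccs_eq :: "('n \<Rightarrow> real) \<Rightarrow> ('n \<times> 'n) set \<Rightarrow> 'n \<Rightarrow> 'n \<Rightarrow> real"
  and ccs_sw' :: "('n \<Rightarrow> real) \<Rightarrow> ('n \<times> 'n) set \<Rightarrow> 'n \<Rightarrow> real"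
  and ccs_send :: "('n \<Rightarrow> real) \<Rightarrow> ('n \<times> 'n) set \<Rightarrow> 'n \<Rightarrow> real"
where
  "ccs_sw p E i = ccs_init p + (\<Sum>j\<in>J_L E i. ccs_send p E j)"
| "ccs_eq p E i j =
     (1 - max (ccs_sw p E i) (ccs_sw p E j)) * p j / max (ccs_sp p E i) (ccs_sp p E j)"
| "ccs_sw' p E i = ccs_sw p E i + (\<Sum>j\<in>J_E E i. ccs_eq p E i j)"
| "ccs_send p E i = (1 - ccs_sw' p E i) * p i / ccs_sp' p E i"
  by pat_completeness auto
termination
proof (relation "inv_image less_than (\<lambda>x. case x of
       Inl (Inl (p, E, i)) \<Rightarrow> 4 * (CARD('a) - deg E i)
     | Inl (Inr (p, E, i, j)) \<Rightarrow> 4 * (CARD('a) - min (deg E i) (deg E j)) + 1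
     | Inr (Inl (p, E, i)) \<Rightarrow> 4 * (CARD('a) - deg E i) + 2
     | Inr (Inr (p, E, i)) \<Rightarrow> 4 * (CARD('a) - deg E i) + 3)", goal_cases)
  case (2 p E i j)
  then have "deg E i < deg E j" by (simp add: J_L_def)
  then show ?case using deg_le_card[of E j] by simp
qed (auto simp: J_E_def)

declare ccs_sw.simps [simp del] ccs_eq.simps [simp del]
  ccs_sw'.simps [simp del] ccs_send.simps [simp del]

text \<open>\<open>ccs p E i\<close> is the communication vector \<open>w_i\<close>; its \<open>j\<close>-th component is \<open>w_{j,i}\<close>.\<close>

definition ccs :: "('n::finite \<Rightarrow> real) \<Rightarrow> ('n \<times> 'n) set \<Rightarrow> 'n \<Rightarrow> real^'n" where
  "ccs p E i = (\<chi> j.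
     if j = i then
       (if J_SE E i \<noteq> {} then ccs_init p + (1 - ccs_sw' p E i) * p i / ccs_sp' p E i
        else ccs_init p + (1 - ccs_sw p E i))
     else if j \<in> J_L E i then ccs_send p E j
     else if j \<in> J_E E i then ccs_eq p E i j
     else if j \<in> J_SE E i then (1 - ccs_sw' p E i) * p j / ccs_sp' p E i
     else 0)"

definition expected_comm :: "('n::finite \<Rightarrow> real) \<Rightarrow> ('n \<Rightarrow> real^'n) \<Rightarrow> real^'n^'n" where
  "expected_comm p w =
     mat 1 + (\<Sum>i\<in>UNIV. p i *\<^sub>R (\<chi> r c. (w i - axis i 1) $ r * axis i 1 $ c))"

definition doubly_stochastic :: "real^'n^'n \<Rightarrow> bool" where
  "doubly_stochastic A \<longleftrightarrow> (\<forall>r c. 0 \<le> A $ r $ c) \<and>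
     (\<forall>r. (\<Sum>c\<in>UNIV. A $ r $ c) = 1) \<and> (\<forall>c. (\<Sum>r\<in>UNIV. A $ r $ c) = 1)"

text \<open>The properties that the procedure is designed to deliver. They also imply that no
  essential division by zero occurred in it. They are not automatic: let the scores be uniform
  and take the graph with vertices \<open>i\<close>, \<open>h_1,...,h_m\<close>, \<open>b_1,...,b_m\<close> (\<open>m > 4\<close>), where every
  \<open>h_k\<close> is adjacent to \<open>i\<close> and to all \<open>b_l\<close>, and the \<open>b_l\<close> form a clique. Then each \<open>h_k\<close> sends
  the coefficient \<open>1/4\<close> to \<open>i\<close>, so that \<open>w_{i,i} = 1 - m/4 < 0\<close>.\<close>

definition ccs_guarantee :: "('n::finite \<Rightarrow> real) \<Rightarrow> ('n \<Rightarrow> real^'n) \<Rightarrow> bool" where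
  "ccs_guarantee p w \<longleftrightarrow>
     (\<forall>i. (\<Sum>j\<in>UNIV. w i $ j) = 1) \<and>
     (\<forall>i. w i $ i \<ge> 1 / real CARD('n)) \<and>
     (\<forall>i j. p j * w j $ i = p i * w i $ j) \<and>
     transpose (expected_comm p w) = expected_comm p w \<and>
     doubly_stochastic (expected_comm p w)"

section \<open>Objective and standing assumptions\<close>

definition grad :: "('a::real_inner \<Rightarrow> real) \<Rightarrow> 'a \<Rightarrow> 'a" where
  "grad f x = (THE g. GDERIV f x :> g)"

definition local_obj :: "('n \<Rightarrow> 'b measure) \<Rightarrow> (real^'d \<Rightarrow> 'b \<Rightarrow> real) \<Rightarrow> 'n \<Rightarrow> real^'d \<Rightarrow> real" where
  "local_obj D l i x = (\<integral>\<xi>. l x \<xi> \<partial>D i)"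

definition global_obj ::
    "('n::finite \<Rightarrow> real) \<Rightarrow> ('n \<Rightarrow> 'b measure) \<Rightarrow> (real^'d \<Rightarrow> 'b \<Rightarrow> real) \<Rightarrow> real^'d \<Rightarrow> real" where
  "global_obj p D l x = (\<Sum>i\<in>UNIV. p i * local_obj D l i x)"

definition scores :: "('n::finite \<Rightarrow> real) \<Rightarrow> bool" where
  "scores p \<longleftrightarrow> (\<forall>i. 0 \<le> p i) \<and> (\<Sum>i\<in>UNIV. p i) = 1"

definition standing_assumptions ::
    "('n::finite \<Rightarrow> real) \<Rightarrow> ('n \<Rightarrow> 'b measure) \<Rightarrow> (real^'d \<Rightarrow> 'b \<Rightarrow> real) \<Rightarrow>
     real \<Rightarrow> real \<Rightarrow> real \<Rightarrow> bool" where
  "standing_assumptions p D l L \<sigma> \<zeta> \<longleftrightarrow>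
     (\<forall>i. prob_space (D i)) \<and>
     (\<forall>i x. integrable (D i) (l x)) \<and>
     (\<forall>i x. \<forall>\<xi>\<in>space (D i). (\<lambda>y. l y \<xi>) differentiable (at x)) \<and>
     (\<forall>i x. local_obj D l i differentiable (at x)) \<and>
     L-lipschitz_on UNIV (grad (global_obj p D l)) \<and>
     (\<forall>i. L-lipschitz_on UNIV (grad (local_obj D l i))) \<and>
     (\<forall>i x. has_bochner_integral (D i) (\<lambda>\<xi>. grad (\<lambda>y. l y \<xi>) x) (grad (local_obj D l i) x)) \<and>
     \<sigma> \<ge> 0 \<and> \<zeta> \<ge> 0 \<and>
     (\<forall>x. (\<Sum>i\<in>UNIV. p i * (norm (grad (global_obj p D l) x - grad (local_obj D l i) x))\<^sup>2) \<le> \<zeta>\<^sup>2) \<and>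
     (\<forall>i x. (\<integral>\<^sup>+\<xi>. ennreal ((norm (grad (local_obj D l i) x - grad (\<lambda>y. l y \<xi>) x))\<^sup>2) \<partial>D i)
              \<le> ennreal (\<sigma>\<^sup>2))"

section \<open>The SWIFT iteration\<close>

text \<open>The iteration is defined pathwise: \<open>a t\<close> is the client active at iteration \<open>t\<close>, and
  \<open>z k t m\<close> is the \<open>m\<close>-th sample of the mini-batch that client \<open>k\<close> uses if it is active at
  iteration \<open>t\<close>. Samples of inactive clients are never used; indexing the samples by a fixed
  client makes \<open>z k t m \<sim> D k\<close> and the independence of clients and samples expressible for
  random \<open>a\<close>.\<close>

primrec counter :: "(nat \<Rightarrow> 'n) \<Rightarrow> nat \<Rightarrow> 'n \<Rightarrow> nat" where
  "counter a 0 i = 1"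
| "counter a (Suc t) i = (if a t = i then counter a t i + 1 else counter a t i)"

definition comm_set :: "nat \<Rightarrow> nat \<Rightarrow> nat set" where
  "comm_set s T = {t. t mod (s + 1) = 0 \<and> t \<le> T}"

definition comm_mat ::
    "nat \<Rightarrow> nat \<Rightarrow> (nat \<Rightarrow> 'n::finite \<Rightarrow> real^'n) \<Rightarrow> (nat \<Rightarrow> 'n) \<Rightarrow> nat \<Rightarrow> real^'n^'n" where
  "comm_mat s T w a t =
     (if counter a t (a t) \<in> comm_set s T
      then mat 1 + (\<chi> r c. (w t (a t) - axis (a t) 1) $ r * axis (a t) 1 $ c)
      else mat 1)"

definition batch_grad ::
    "(real^'d \<Rightarrow> 'b \<Rightarrow> real) \<Rightarrow> nat \<Rightarrow> (nat \<Rightarrow> 'b) \<Rightarrow> real^'d \<Rightarrow> real^'d" where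
  "batch_grad l M \<xi> x = (1 / real M) *\<^sub>R (\<Sum>m=1..M. grad (\<lambda>y. l y (\<xi> m)) x)"

definition grad_mat ::
    "(real^'d \<Rightarrow> 'b \<Rightarrow> real) \<Rightarrow> nat \<Rightarrow> (nat \<Rightarrow> 'n) \<Rightarrow> ('n \<Rightarrow> nat \<Rightarrow> nat \<Rightarrow> 'b) \<Rightarrow>
     nat \<Rightarrow> real^'n^'d \<Rightarrow> real^'n^'d" where
  "grad_mat l M a z t X =
     (\<chi> r c. if c = a t then batch_grad l M (z (a t) t) (column (a t) X) $ r else 0)"

primrec models ::
    "(real^'d \<Rightarrow> 'b \<Rightarrow> real) \<Rightarrow> nat \<Rightarrow> real \<Rightarrow> real^'d \<Rightarrow> nat \<Rightarrow> nat \<Rightarrow>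
     (nat \<Rightarrow> 'n::finite \<Rightarrow> real^'n) \<Rightarrow> (nat \<Rightarrow> 'n) \<Rightarrow> ('n \<Rightarrow> nat \<Rightarrow> nat \<Rightarrow> 'b) \<Rightarrow>
     nat \<Rightarrow> real^'n^'d" where
  "models l M \<gamma> x0 s T w a z 0 = (\<chi> r c. x0 $ r)"
| "models l M \<gamma> x0 s T w a z (Suc t) =
     models l M \<gamma> x0 s T w a z t ** comm_mat s T w a t
     - \<gamma> *\<^sub>R grad_mat l M a z t (models l M \<gamma> x0 s T w a z t)"

text \<open>\<open>ordered_prod A j t\<close> is \<open>A (j+1) ** A (j+2) ** ... ** A t\<close>.\<close>

definition ordered_prod :: "(nat \<Rightarrow> real^'n^'n) \<Rightarrow> nat \<Rightarrow> nat \<Rightarrow> real^'n^'n" where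
  "ordered_prod A j t = foldr (**) (map A [Suc j..<Suc t]) (mat 1)"

definition swift_sampling ::
    "'w measure \<Rightarrow> ('n::finite \<Rightarrow> real) \<Rightarrow> ('n \<Rightarrow> 'b measure) \<Rightarrow> nat \<Rightarrow>
     (nat \<Rightarrow> 'w \<Rightarrow> 'n) \<Rightarrow> ('n \<Rightarrow> nat \<Rightarrow> nat \<Rightarrow> 'w \<Rightarrow> 'b) \<Rightarrow> bool" where
  "swift_sampling P p D M act smp \<longleftrightarrow>
     prob_space P \<and>
     (\<forall>t. act t \<in> measurable P (count_space UNIV)) \<and>
     (\<forall>t i. measure P {\<omega> \<in> space P. act t \<omega> = i} = p i) \<and>
     (\<forall>k t. \<forall>m\<in>{1..M}. smp k t m \<in> measurable P (D k) \<and> distr P (D k) (smp k t m) = D k) \<and>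
     prob_space.indep_sets P
       (\<lambda>v. case v of
          Inl t \<Rightarrow> {act t -` A \<inter> space P | A. A \<in> sets (count_space UNIV)}
        | Inr (k, t, m) \<Rightarrow> {smp k t m -` A \<inter> space P | A. A \<in> sets (D k)})
       (range Inl \<union> Inr ` (UNIV \<times> UNIV \<times> {1..M}))"

end

theory Submission
  imports Defs
begin

text \<open>Only column \<open>i\<^sub>j\<close> of \<open>G\<close> is nonzero, so the \<open>j\<close>-th summand is at most
  \<open>\<bar>g\<^sub>j\<bar>\<^sup>2 \<bar>r\<^sub>t\<bar>\<^sup>2\<close>, where the row vector \<open>r\<close> starts at \<open>e\<close> with index \<open>i\<^sub>j\<close> and is multiplied from the
  right by \<open>W - Wbar\<close> in each later iteration. Which clients would communicate is decided by the
  counters, that is, by the past. The key estimate is therefore uniform in the set \<open>S\<close> of communicating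
  clients: averaging over the active client contracts \<open>\<bar>r\<bar>\<^sup>2\<close> by a factor \<open>\<rho> < 1\<close> depending only on
  \<open>n\<close>. For this, \<open>Lap = I - Wbar\<close> is a weighted graph Laplacian, and the average is at most
  \<open>2 \<langle>r, Lap r\<rangle> - \<bar>Lap r\<bar>\<^sup>2 = \<bar>r\<bar>\<^sup>2 - \<bar>r - Lap r\<bar>\<^sup>2\<close>, while all outgoing weights are
  at most \<open>(n - 1) / (2 n - 1)\<close>, which gives \<open>\<bar>Lap\<bar> \<le> (2 n - 2) / (2 n - 1) < 1\<close>. Summing the geometric
  series against \<open>E \<bar>g\<^sub>j\<bar>\<^sup>2 \<le> 2 \<sigma>\<^sup>2 / M + 2 E \<bar>\<nabla>f\<bar>\<^sup>2\<close> yields the constant \<open>2 / (1 - \<rho>)\<close>.\<close>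

section \<open>Mean-square contraction of one communication step\<close>

text \<open>Cauchy-Schwarz with each weight split evenly as
  \<open>sqrt (c j) * sqrt (c j)\<close>.\<close>

lemma weighted_sum_squared_le:
  fixes c x :: "'a \<Rightarrow> real"
  assumes "\<And>j. j \<in> A \<Longrightarrow> 0 \<le> c j"
  shows "(\<Sum>j\<in>A. c j * x j)\<^sup>2 \<le> (\<Sum>j\<in>A. c j) * (\<Sum>j\<in>A. c j * (x j)\<^sup>2)"
proof -
  have "(\<Sum>j\<in>A. sqrt (c j) * (sqrt (c j) * x j))\<^sup>2
      \<le> (\<Sum>j\<in>A. (sqrt (c j))\<^sup>2) * (\<Sum>j\<in>A. (sqrt (c j) * x j)\<^sup>2)"
    by (rule Cauchy_Schwarz_ineq_sum)
  also have "(\<Sum>j\<in>A. sqrt (c j) * (sqrt (c j) * x j)) = (\<Sum>j\<in>A. c j * x j)"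
    using assms by (intro sum.cong) (auto simp: mult.assoc[symmetric])
  also have "(\<Sum>j\<in>A. (sqrt (c j))\<^sup>2) = (\<Sum>j\<in>A. c j)"
    using assms by (intro sum.cong) auto
  also have "(\<Sum>j\<in>A. (sqrt (c j) * x j)\<^sup>2) = (\<Sum>j\<in>A. c j * (x j)\<^sup>2)"
    using assms by (intro sum.cong) (auto simp: power_mult_distrib)
  finally show ?thesis .
qed

text \<open>Here \<open>y\<close> is the Laplacian applied to \<open>r\<close>. Symmetry turns the
  total energy into \<open>2 * I\<close> with \<open>I\<close> the quadratic form; Cauchy-Schwarz in
  every row gives \<open>Y \<le> 2 * \<kappa> * I\<close>, so the Laplacian has norm at most
  \<open>2 * \<kappa>\<close>. It remains to optimise \<open>2 * I - Y\<close> under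
  \<open>I\<^sup>2 \<le> R * Y\<close>.\<close>

lemma weighted_laplacian_contraction:
  fixes c :: "'n::finite \<Rightarrow> 'n \<Rightarrow> real" and r :: "'n \<Rightarrow> real" and \<kappa> :: real
  assumes nonneg: "\<And>i j. 0 \<le> c i j" and sym: "\<And>i j. c i j = c j i"
    and row: "\<And>i. (\<Sum>j\<in>UNIV. c i j) \<le> \<kappa>" and \<kappa>: "\<kappa> \<le> 1 / 2"
  shows "(\<Sum>k\<in>UNIV. (\<Sum>j\<in>UNIV. c k j * (r k - r j)\<^sup>2) - (\<Sum>j\<in>UNIV. c k j * (r k - r j))\<^sup>2)
    \<le> (1 - (1 - 2 * \<kappa>)\<^sup>2) * (\<Sum>k\<in>UNIV. (r k)\<^sup>2)"
proof -
  define y where "y k = (\<Sum>j\<in>UNIV. c k j * (r k - r j))" for k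
  define D where "D k = (\<Sum>j\<in>UNIV. c k j * (r k - r j)\<^sup>2)" for k
  define R where "R = (\<Sum>k\<in>UNIV. (r k)\<^sup>2)"
  define Y where "Y = (\<Sum>k\<in>UNIV. (y k)\<^sup>2)"
  define I where "I = (\<Sum>k\<in>UNIV. r k * y k)"
  have D0: "0 \<le> D k" for k
    unfolding D_def by (intro sum_nonneg mult_nonneg_nonneg nonneg) auto
  have yD: "(y k)\<^sup>2 \<le> \<kappa> * D k" for k
  proof -
    have "(y k)\<^sup>2 \<le> (\<Sum>j\<in>UNIV. c k j) * D k"
      unfolding y_def D_def by (rule weighted_sum_squared_le) (rule nonneg)
    also have "\<dots> \<le> \<kappa> * D k" by (intro mult_right_mono row D0)
    finally show ?thesis .
  qed
  \<comment> \<open>One factor of the squared difference is multiplied out; exchanging the two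
    indices shows that both halves contribute \<open>I\<close>.\<close>
  have "(\<Sum>k\<in>UNIV. D k) = (\<Sum>k\<in>UNIV. \<Sum>j\<in>UNIV. c k j * (r k - r j) * r k)
      - (\<Sum>k\<in>UNIV. \<Sum>j\<in>UNIV. c k j * (r k - r j) * r j)"
    unfolding D_def sum_subtractf[symmetric]
    by (intro sum.cong refl) (simp add: power2_eq_square algebra_simps)
  also have "(\<Sum>k\<in>UNIV. \<Sum>j\<in>UNIV. c k j * (r k - r j) * r j)
      = (\<Sum>k\<in>UNIV. \<Sum>j\<in>UNIV. c k j * (r j - r k) * r k)"
    by (subst sum.swap) (intro sum.cong refl, simp add: sym)
  also have "\<dots> = - (\<Sum>k\<in>UNIV. \<Sum>j\<in>UNIV. c k j * (r k - r j) * r k)"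
    unfolding sum_negf[symmetric] by (intro sum.cong refl) (simp add: algebra_simps)
  also have "(\<Sum>k\<in>UNIV. \<Sum>j\<in>UNIV. c k j * (r k - r j) * r k) = I"
    unfolding I_def y_def by (intro sum.cong refl) (simp add: sum_distrib_left sum_distrib_right mult.commute)
  finally have DI: "(\<Sum>k\<in>UNIV. D k) = 2 * I" by simp
  have I0: "0 \<le> I" using DI sum_nonneg[of UNIV D] D0 by simp
  have "Y \<le> \<kappa> * (\<Sum>k\<in>UNIV. D k)"
    unfolding Y_def sum_distrib_left by (intro sum_mono yD)
  then have YI: "Y \<le> 2 * \<kappa> * I" by (simp add: DI)
  have IRY: "I\<^sup>2 \<le> R * Y" unfolding I_def R_def Y_def by (rule Cauchy_Schwarz_ineq_sum)
  have R0: "0 \<le> R" unfolding R_def by (intro sum_nonneg) auto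
  have "2 * I - Y \<le> (1 - (1 - 2 * \<kappa>)\<^sup>2) * R"
  proof (cases "I = 0")
    case True
    have Y0: "0 \<le> Y" unfolding Y_def by (intro sum_nonneg) auto
    \<comment> \<open>\<open>undefined\<close> is merely some vertex: its row sum is nonnegative and
      bounded by \<open>\<kappa>\<close>.\<close>
    have \<kappa>0: "0 \<le> \<kappa>"
    proof -
      have "0 \<le> (\<Sum>j\<in>UNIV. c undefined j)" by (intro sum_nonneg nonneg)
      then show ?thesis using row[of undefined] by linarith
    qed
    have "(1 - 2 * \<kappa>)\<^sup>2 \<le> 1" using \<kappa> \<kappa>0 by (intro power_le_one) auto
    then have "0 \<le> (1 - (1 - 2 * \<kappa>)\<^sup>2) * R" using R0 by (intro mult_nonneg_nonneg) auto
    then show ?thesis using True Y0 by linarith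
  next
    case False
    then have Ipos: "0 < I" using I0 by simp
    then have Rpos: "0 < R" using IRY R0 by (cases "R = 0") auto
    have "I * I \<le> R * (2 * \<kappa> * I)"
      using IRY mult_left_mono[OF YI R0] by (simp add: power2_eq_square)
    then have IR: "I \<le> 2 * \<kappa> * R" using Ipos by (simp add: mult.commute mult.left_commute)
    have "(1 - 2 * \<kappa>) * R \<le> R - I" using IR by (simp add: algebra_simps)
    then have "((1 - 2 * \<kappa>) * R)\<^sup>2 \<le> (R - I)\<^sup>2" using \<kappa> R0 by (intro power_mono) auto
    \<comment> \<open>Multiplying by \<open>R\<close> lets \<open>I\<^sup>2 \<le> R * Y\<close>
      eliminate \<open>Y\<close>: the left side is at most
      \<open>R\<^sup>2 - (R - I)\<^sup>2\<close>.\<close>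
    then have "R * (2 * I - Y) \<le> R * ((1 - (1 - 2 * \<kappa>)\<^sup>2) * R)"
      using IRY by (simp add: power2_eq_square algebra_simps)
    then show ?thesis using Rpos by simp
  qed
  then show ?thesis
    by (simp add: sum_subtractf DI Y_def R_def flip: y_def D_def)
qed

text \<open>The centred matrix for active client \<open>k\<close>, with the set \<open>S\<close> of
  clients due to communicate kept as a free parameter. In the process \<open>S\<close> is decided by
  the past, so it can be frozen while \<open>k\<close> is averaged.\<close>

definition comm_step :: "('n::finite \<Rightarrow> real) \<Rightarrow> ('n \<Rightarrow> real^'n) \<Rightarrow> 'n set \<Rightarrow> 'n \<Rightarrow> real^'n^'n" where
  "comm_step p w S k =
     (if k \<in> S then mat 1 + (\<chi> r c. (w k - axis k 1) $ r * axis k 1 $ c) else mat 1)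
     - expected_comm p w"

lemma expected_comm_nth:
  "expected_comm p w $ j $ c = (if j = c then 1 else 0) + p c * (w c $ j - (if j = c then 1 else 0))"
proof -
  have "(\<Sum>i\<in>UNIV. p i * ((w i - axis i 1) $ j * axis i 1 $ c))
      = (\<Sum>i\<in>UNIV. if i = c then p c * (w c $ j - (if j = c then 1 else 0)) else 0)"
    by (intro sum.cong) (auto simp: axis_def)
  then show ?thesis
    by (auto simp: expected_comm_def mat_def)
qed

text \<open>Since the communication vectors sum to one, \<open>r $ c\<close> can be moved inside the
  sums, which leaves only differences of coordinates of \<open>r\<close>. The random part affects
  the active coordinate alone.\<close>

lemma vector_comm_step_nth:
  assumes "(\<Sum>j\<in>UNIV. w k $ j) = 1" "(\<Sum>j\<in>UNIV. w c $ j) = 1"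
  shows "(r v* comm_step p w S k) $ c =
    (if k \<in> S \<and> c = k then \<Sum>j\<in>UNIV. w k $ j * (r $ j - r $ k) else 0)
    - p c * (\<Sum>j\<in>UNIV. w c $ j * (r $ j - r $ c))"
proof -
  have b: "(\<Sum>j\<in>UNIV. w i $ j * (r $ j - r $ i)) = (\<Sum>j\<in>UNIV. r $ j * w i $ j) - r $ i"
    if "(\<Sum>j\<in>UNIV. w i $ j) = 1" for i
    using that
    by (simp add: right_diff_distrib sum_subtractf sum_distrib_right[symmetric] mult.commute[of "r $ _"])
  have "(r v* comm_step p w S k) $ c
    = (\<Sum>j\<in>UNIV. (if k \<in> S \<and> c = k then r $ j * w k $ j - (if j = k then r $ k else 0) else 0)
      - p c * (r $ j * w c $ j - (if j = c then r $ c else 0)))"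
    unfolding vector_matrix_mult_def comm_step_def
    by (auto simp: expected_comm_nth mat_def axis_def algebra_simps intro!: sum.cong)
  also have "\<dots> = (if k \<in> S \<and> c = k then (\<Sum>j\<in>UNIV. r $ j * w k $ j) - r $ k else 0)
      - p c * ((\<Sum>j\<in>UNIV. r $ j * w c $ j) - r $ c)"
    by (cases "k \<in> S"; cases "c = k") (simp_all add: sum_subtractf sum_negf sum_distrib_left[symmetric])
  finally show ?thesis using assms by (simp add: b)
qed

text \<open>The outgoing weight \<open>p k * (1 - w k $ k)\<close> of a client is at most both \<open>p k * (1 - 1 / n)\<close> and
  \<open>1 - p k\<close>, hence at most \<open>(n - 1) / (2 * n - 1) < 1 / 2\<close>.\<close>

definition contraction_rate :: "nat \<Rightarrow> real" where
  "contraction_rate n = 1 - (1 - 2 * ((real n - 1) / (2 * real n - 1)))\<^sup>2"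

text \<open>The squared norm equals a deterministic Laplacian part plus a correction
  \<open>(1 - 2 * p k) * (b k)\<^sup>2\<close> when the active client \<open>k\<close> lies in
  \<open>S\<close>. After averaging, the terms are compared client by client with
  \<open>D k - (p k * b k)\<^sup>2\<close>, whatever \<open>S\<close> is, and the Laplacian estimate
  applies.\<close>

lemma expected_norm_comm_step_le:
  fixes p :: "'n::finite \<Rightarrow> real" and w :: "'n \<Rightarrow> real^'n" and r :: "real^'n"
  assumes p: "scores p" and w: "ccs_guarantee p w"
  shows "(\<Sum>k\<in>UNIV. p k * (norm (r v* comm_step p w S k))\<^sup>2)
    \<le> contraction_rate CARD('n) * (norm r)\<^sup>2"
proof -
  define n where "n = real CARD('n)"
  have n: "n \<ge> 1" unfolding n_def by (simp add: Suc_leI)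
  define \<kappa> where "\<kappa> = (n - 1) / (2 * n - 1)"
  have \<kappa>: "\<kappa> \<le> 1 / 2" using n by (simp add: \<kappa>_def field_simps)
  have p1: "(\<Sum>i\<in>UNIV. p i) = 1" and p0: "0 \<le> p i" for i
    using p by (auto simp: scores_def)
  have wsum: "(\<Sum>j\<in>UNIV. w i $ j) = 1" and wii: "w i $ i \<ge> 1 / n"
    and wsym: "p j * w j $ i = p i * w i $ j" for i j
    using w by (auto simp: ccs_guarantee_def n_def)
  \<comment> \<open>Up to transposition these are the off-diagonal entries of the expected matrix,
    which is doubly stochastic.\<close>
  have pw: "0 \<le> p i * w i $ j" if "i \<noteq> j" for i j
  proof -
    have "0 \<le> expected_comm p w $ j $ i"
      using w unfolding ccs_guarantee_def doubly_stochastic_def by blast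
    then show ?thesis using that by (simp add: expected_comm_nth)
  qed
  have pw': "0 \<le> p i * w i $ j" for i j
  proof (cases "i = j")
    case True
    have "0 \<le> w i $ i" using wii[of i] n by (smt (verit) divide_nonneg_nonneg)
    then show ?thesis using True p0 by simp
  qed (rule pw)
  \<comment> \<open>Signs are known only after multiplication by the score, so a client of score
    zero has to be excluded here and treated separately below.\<close>
  have w0: "0 \<le> w i $ j" if "p i \<noteq> 0" for i j
    using pw'[of i j] p0[of i] that by (simp add: zero_le_mult_iff)
  have w1: "w i $ j \<le> 1" if "p i \<noteq> 0" for i j
    using member_le_sum[of j UNIV "\<lambda>j. w i $ j"] w0[OF that] by (simp add: wsum)
  define c where "c i j = (if i = j then 0 else p i * w i $ j)" for i j
  have c0: "0 \<le> c i j" for i j by (simp add: c_def pw)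
  have csym: "c i j = c j i" for i j by (simp add: c_def wsym)
  have csum: "(\<Sum>j\<in>UNIV. c i j) = p i * (1 - w i $ i)" for i
  proof -
    have "(\<Sum>j\<in>UNIV. c i j) = (\<Sum>j\<in>UNIV. p i * w i $ j - (if j = i then p i * w i $ i else 0))"
      by (intro sum.cong) (auto simp: c_def)
    also have "\<dots> = p i * (1 - w i $ i)"
      by (simp add: sum_subtractf sum_distrib_left[symmetric] wsum right_diff_distrib)
    finally show ?thesis .
  qed
  \<comment> \<open>By symmetry the outgoing weights are \<open>p j * w j $ i\<close>, each at most
    \<open>p j\<close>, and the scores other than \<open>p i\<close> add up to
    \<open>1 - p i\<close>.\<close>
  have csum1: "(\<Sum>j\<in>UNIV. c i j) \<le> 1 - p i" for i
  proof -
    have cj: "c i j \<le> (if j = i then 0 else p j)" for j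
    proof (cases "i = j \<or> p j = 0")
      case True then show ?thesis using csym[of i j] by (auto simp: c_def)
    next
      case False
      then have "c i j = p j * w j $ i" using wsym[of i j] by (simp add: c_def)
      also have "\<dots> \<le> p j" using w1[of j i] False p0[of j] by (simp add: mult_left_le)
      finally show ?thesis using False by auto
    qed
    have "(\<Sum>j\<in>UNIV. c i j) \<le> (\<Sum>j\<in>UNIV. p j - (if j = i then p i else 0))"
    proof (rule sum_mono)
      show "c i j \<le> p j - (if j = i then p i else 0)" for j using cj[of j] by auto
    qed
    then show ?thesis by (simp add: sum_subtractf p1)
  qed
  have csum\<kappa>: "(\<Sum>j\<in>UNIV. c i j) \<le> \<kappa>" for i
  proof -
    define x where "x = (\<Sum>j\<in>UNIV. c i j)"
    have "x \<le> p i * (1 - 1 / n)"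
      unfolding x_def csum by (intro mult_left_mono p0) (use wii in auto)
    \<comment> \<open>The bound \<open>x \<le> 1 - p i\<close> then replaces \<open>p i\<close> by
      \<open>1 - x\<close>, and the result is solved for \<open>x\<close>.\<close>
    then have "x * n \<le> p i * (n - 1)" using n by (simp add: field_simps)
    also have "\<dots> \<le> (1 - x) * (n - 1)"
      using csum1[of i] n by (intro mult_right_mono) (auto simp: x_def)
    finally have "x * (2 * n - 1) \<le> n - 1" by (simp add: algebra_simps)
    then show ?thesis using n by (simp add: \<kappa>_def pos_le_divide_eq flip: x_def)
  qed
  define b where "b k = (\<Sum>j\<in>UNIV. w k $ j * (r $ j - r $ k))" for k
  define D where "D k = (\<Sum>j\<in>UNIV. c k j * (r $ k - r $ j)\<^sup>2)" for k
  \<comment> \<open>Identifies \<open>p k * b k\<close> as minus the \<open>k\<close>-th component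
    of the Laplacian of \<open>r\<close>.\<close>
  have pb: "(\<Sum>j\<in>UNIV. c k j * (r $ k - r $ j)) = - (p k * b k)" for k
    unfolding b_def sum_distrib_left sum_negf[symmetric]
    by (intro sum.cong) (auto simp: c_def algebra_simps)
  have D0: "0 \<le> D k" for k
    unfolding D_def by (intro sum_nonneg mult_nonneg_nonneg c0) auto
  \<comment> \<open>Jensen's inequality for the probability weights \<open>w k\<close>.\<close>
  have D1: "p k * (b k)\<^sup>2 \<le> D k" for k
  proof (cases "p k = 0")
    case False
    have "(b k)\<^sup>2 \<le> (\<Sum>j\<in>UNIV. w k $ j) * (\<Sum>j\<in>UNIV. w k $ j * (r $ j - r $ k)\<^sup>2)"
      unfolding b_def by (rule weighted_sum_squared_le) (rule w0[OF False])
    then have "p k * (b k)\<^sup>2 \<le> p k * (\<Sum>j\<in>UNIV. w k $ j * (r $ j - r $ k)\<^sup>2)"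
      using p0[of k] by (intro mult_left_mono) (simp_all add: wsum)
    also have "\<dots> = D k"
      unfolding D_def sum_distrib_left by (intro sum.cong) (auto simp: c_def power2_commute)
    finally show ?thesis .
  qed (use D0 in auto)
  \<comment> \<open>If \<open>p k\<close> exceeds \<open>1 / 2\<close>, the worst case is that \<open>k\<close> does not communicate; then \<open>k\<close> contributes
    as if it communicated with score \<open>1 / 2\<close>, which still bounds its total outgoing weight.\<close>
  have D2: "2 * (p k * b k)\<^sup>2 \<le> D k" if "p k > 1 / 2" for k
  proof -
    have "(p k * b k)\<^sup>2 \<le> (\<Sum>j\<in>UNIV. c k j) * D k"
      using weighted_sum_squared_le[of UNIV "c k" "\<lambda>j. r $ k - r $ j"] c0 by (simp add: pb D_def)
    also have "\<dots> \<le> (1 / 2) * D k"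
      using csum1[of k] that by (intro mult_right_mono D0) auto
    finally show ?thesis by simp
  qed
  have norm2: "(norm (r v* comm_step p w S k))\<^sup>2
      = (\<Sum>c\<in>UNIV. (p c * b c)\<^sup>2) + (if k \<in> S then (1 - 2 * p k) * (b k)\<^sup>2 else 0)" for k
  proof -
    have "(norm (r v* comm_step p w S k))\<^sup>2
        = (\<Sum>c\<in>UNIV. ((if k \<in> S \<and> c = k then b k else 0) - p c * b c)\<^sup>2)"
      unfolding norm_vec_def L2_set_def b_def
      by (subst real_sqrt_pow2) (auto intro!: sum_nonneg sum.cong simp: vector_comm_step_nth wsum)
    also have "\<dots> = (\<Sum>c\<in>UNIV. (p c * b c)\<^sup>2
        + (if c = k then (if k \<in> S then (1 - 2 * p k) * (b k)\<^sup>2 else 0) else 0))"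
      by (intro sum.cong) (auto simp: power2_eq_square algebra_simps)
    finally show ?thesis by (simp add: sum.distrib)
  qed
  have "(\<Sum>k\<in>UNIV. p k * (norm (r v* comm_step p w S k))\<^sup>2)
      = (\<Sum>c\<in>UNIV. (p c * b c)\<^sup>2)
        + (\<Sum>k\<in>UNIV. p k * (if k \<in> S then (1 - 2 * p k) * (b k)\<^sup>2 else 0))"
    unfolding norm2 by (simp add: distrib_left sum.distrib sum_distrib_right[symmetric] p1)
  also have "\<dots> \<le> (\<Sum>k\<in>UNIV. D k - (p k * b k)\<^sup>2)"
    unfolding sum.distrib[symmetric]
  proof (rule sum_mono)
    fix k
    show "(p k * b k)\<^sup>2 + p k * (if k \<in> S then (1 - 2 * p k) * (b k)\<^sup>2 else 0)
        \<le> D k - (p k * b k)\<^sup>2"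
    proof (cases "p k > 1 / 2")
      case True
      have "(1 - 2 * p k) * (b k)\<^sup>2 \<le> 0" using True by (intro mult_nonpos_nonneg) auto
      then have "p k * (if k \<in> S then (1 - 2 * p k) * (b k)\<^sup>2 else 0) \<le> 0"
        by (intro mult_nonneg_nonpos p0) auto
      then show ?thesis using D2[OF True] by linarith
    next
      case False
      \<comment> \<open>Now the correction is nonnegative, so communication is the worst case; the
        squares of \<open>p k * b k\<close> cancel and exactly \<open>D1\<close> remains.\<close>
      have "p k * (if k \<in> S then (1 - 2 * p k) * (b k)\<^sup>2 else 0) \<le> p k * ((1 - 2 * p k) * (b k)\<^sup>2)"
        using False p0[of k] by (intro mult_left_mono) auto
      then show ?thesis using D1[of k] by (simp add: power2_eq_square algebra_simps)
    qed
  qed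
  also have "\<dots> \<le> (1 - (1 - 2 * \<kappa>)\<^sup>2) * (\<Sum>k\<in>UNIV. (r $ k)\<^sup>2)"
    using weighted_laplacian_contraction[of c \<kappa> "\<lambda>k. r $ k", OF c0 csym csum\<kappa> \<kappa>]
    by (simp add: pb D_def)
  also have "(\<Sum>k\<in>UNIV. (r $ k)\<^sup>2) = (norm r)\<^sup>2"
    unfolding norm_vec_def L2_set_def by (subst real_sqrt_pow2) (auto intro: sum_nonneg)
  finally show ?thesis by (simp add: contraction_rate_def \<kappa>_def n_def)
qed

section \<open>Measurability of gradients and independence\<close>

text \<open>The first argument is approximated pointwise by maps \<open>F i\<close> of finite range.
  For these only countably many sections of \<open>f\<close> occur, each measurable, and continuity
  in the first argument passes to the limit.\<close>

lemma caratheodory_borel_measurable_pair: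
  fixes f :: "'a::{metric_space, second_countable_topology} \<Rightarrow> 'b \<Rightarrow> 'c::metric_space"
  assumes meas: "\<And>x. f x \<in> borel_measurable N"
    and cont: "\<And>y. y \<in> space N \<Longrightarrow> continuous_on UNIV (\<lambda>x. f x y)"
  shows "(\<lambda>z. f (fst z) (snd z)) \<in> borel_measurable (borel \<Otimes>\<^sub>M N)"
proof -
  obtain F :: "nat \<Rightarrow> 'a \<Rightarrow> 'a" where F: "\<And>i. simple_function borel (F i)"
    and lim: "\<And>x. (\<lambda>i. F i x) \<longlonglongrightarrow> x"
    using borel_measurable_implies_sequence_metric[of "\<lambda>x::'a. x" borel undefined] by auto
  show ?thesis
  proof (rule borel_measurable_LIMSEQ_metric)
    fix i
    have g: "(\<lambda>z. F i (fst z)) \<in> measurable (borel \<Otimes>\<^sub>M N) (count_space (range (F i)))"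
    proof (rule measurable_compose[OF measurable_fst])
      show "F i \<in> measurable borel (count_space (range (F i)))"
        using simple_functionD[OF F[of i]] by (subst measurable_count_space_eq2) auto
    qed
    show "(\<lambda>z. f (F i (fst z)) (snd z)) \<in> borel_measurable (borel \<Otimes>\<^sub>M N)"
    proof (rule measurable_compose_countable'[OF _ g])
      show "(\<lambda>z. f x (snd z)) \<in> borel_measurable (borel \<Otimes>\<^sub>M N)" for x
        by (rule measurable_compose[OF measurable_snd meas])
      show "countable (range (F i))"
        using simple_functionD(1)[OF F[of i]] by (simp add: countable_finite)
    qed
  next
    fix z :: "'a \<times> 'b" assume "z \<in> space (borel \<Otimes>\<^sub>M N)"
    then have "continuous_on UNIV (\<lambda>x. f x (snd z))"
      by (intro cont) (auto simp: space_pair_measure)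
    then show "(\<lambda>i. f (F i (fst z)) (snd z)) \<longlonglongrightarrow> f (fst z) (snd z)"
      using lim[of "fst z"] by (auto simp: continuous_on_eq_continuous_at intro: isCont_tendsto_compose)
  qed
qed

lemma borel_measurable_vec_iff:
  fixes f :: "'a \<Rightarrow> real^'d"
  shows "f \<in> borel_measurable N \<longleftrightarrow> (\<forall>i. (\<lambda>x. f x $ i) \<in> borel_measurable N)"
  by (subst borel_measurable_euclidean_space) (auto simp: Basis_vec_def inner_axis)

lemma GDERIV_unique: "GDERIV f x :> g \<Longrightarrow> GDERIV f x :> h \<Longrightarrow> g = h"
proof -
  assume "GDERIV f x :> g" "GDERIV f x :> h"
  then have "(\<lambda>v. inner v g) = (\<lambda>v. inner v h)"
    unfolding gderiv_def by (rule has_derivative_unique)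
  then show "g = h" by (metis vector_eq_ldot)
qed

text \<open>The Riesz representative of the derivative, written in the basis, provides existence;
  with uniqueness this makes the \<open>THE\<close> in \<open>grad\<close> well defined.\<close>

lemma GDERIV_grad:
  fixes f :: "'a::euclidean_space \<Rightarrow> real"
  assumes "f differentiable (at x)"
  shows "GDERIV f x :> grad f x"
proof -
  obtain f' where f': "(f has_derivative f') (at x)"
    using assms by (auto simp: differentiable_def)
  then have "linear f'" by (rule has_derivative_linear)
  define g where "g = (\<Sum>b\<in>Basis. f' b *\<^sub>R b)"
  have "f' v = inner v g" for v
  proof -
    have "f' v = f' (\<Sum>b\<in>Basis. inner v b *\<^sub>R b)" by (simp add: euclidean_representation)
    also have "\<dots> = (\<Sum>b\<in>Basis. inner v b * f' b)"
      using \<open>linear f'\<close> by (simp add: linear_sum linear_cmul)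
    also have "\<dots> = inner v g"
      by (simp add: g_def inner_sum_right mult.commute)
    finally show ?thesis .
  qed
  then have "GDERIV f x :> g"
    using f' unfolding gderiv_def by (metis (no_types, lifting) ext)
  then show ?thesis unfolding grad_def by (rule theI) (rule GDERIV_unique[OF _ \<open>GDERIV f x :> g\<close>])
qed

text \<open>A sequence of step sizes is chosen so that gradient components become limits of
  sequences, under which measurability is closed.\<close>

lemma difference_quotient_tendsto_grad:
  fixes f :: "'a::euclidean_space \<Rightarrow> real"
  assumes "f differentiable (at x)"
  shows "(\<lambda>n. (f (x + inverse (real (Suc n)) *\<^sub>R v) - f x) / inverse (real (Suc n)))
    \<longlonglongrightarrow> inner v (grad f x)"
proof -
  have "(f has_derivative (\<lambda>h. inner h (grad f x))) (at (x + 0 *\<^sub>R v))"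
    using GDERIV_grad[OF assms] by (simp add: gderiv_def)
  then have "((\<lambda>h. f (x + h *\<^sub>R v)) has_derivative (\<lambda>h. inner (h *\<^sub>R v) (grad f x))) (at 0)"
    by (rule has_derivative_compose[rotated]) (auto intro!: derivative_eq_intros)
  then have "((\<lambda>h. f (x + h *\<^sub>R v)) has_field_derivative inner v (grad f x)) (at 0)"
    by (simp add: has_field_derivative_def mult_commute_abs)
  then have lim: "((\<lambda>h. (f (x + h *\<^sub>R v) - f x) / h) \<longlongrightarrow> inner v (grad f x)) (at 0)"
    by (simp add: has_field_derivative_iff)
  have "filterlim (\<lambda>n. inverse (real (Suc n))) (at 0) sequentially"
    using LIMSEQ_inverse_real_of_nat by (simp add: filterlim_at)
  from filterlim_compose[OF lim this] show ?thesis .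
qed

text \<open>Joint measurability is inherited from \<open>l\<close>: differentiability makes
  \<open>l\<close> continuous in the model, hence jointly measurable, and each gradient component is
  a limit of its difference quotients.\<close>

lemma borel_measurable_grad_pair:
  fixes l :: "'a::euclidean_space \<Rightarrow> 'b \<Rightarrow> real"
  assumes meas: "\<And>x. l x \<in> borel_measurable N"
    and diff: "\<And>x y. y \<in> space N \<Longrightarrow> (\<lambda>x. l x y) differentiable (at x)"
  shows "(\<lambda>z. grad (\<lambda>x. l x (snd z)) (fst z)) \<in> borel_measurable (borel \<Otimes>\<^sub>M N)"
proof (subst borel_measurable_euclidean_space, intro ballI)
  fix b :: 'a
  have l: "(\<lambda>z. l (fst z) (snd z)) \<in> borel_measurable (borel \<Otimes>\<^sub>M N)"
    by (intro caratheodory_borel_measurable_pair meas continuous_at_imp_continuous_on ballI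
        differentiable_imp_continuous_within diff)
  have lh: "(\<lambda>z. l (fst z + c *\<^sub>R b) (snd z)) \<in> borel_measurable (borel \<Otimes>\<^sub>M N)" for c
    using measurable_compose[OF _ l, of "\<lambda>z. (fst z + c *\<^sub>R b, snd z)"] by simp
  show "(\<lambda>z. inner (grad (\<lambda>x. l x (snd z)) (fst z)) b) \<in> borel_measurable (borel \<Otimes>\<^sub>M N)"
  proof (rule borel_measurable_LIMSEQ_real)
    show "(\<lambda>n. (l (fst z + inverse (real (Suc n)) *\<^sub>R b) (snd z) - l (fst z) (snd z)) / inverse (real (Suc n)))
        \<longlonglongrightarrow> inner (grad (\<lambda>x. l x (snd z)) (fst z)) b" if "z \<in> space (borel \<Otimes>\<^sub>M N)" for z
      using difference_quotient_tendsto_grad[OF diff, of "snd z" "fst z" b] that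
      by (simp add: space_pair_measure mem_Times_iff inner_commute)
    show "(\<lambda>z. (l (fst z + inverse (real (Suc n)) *\<^sub>R b) (snd z) - l (fst z) (snd z)) / inverse (real (Suc n)))
        \<in> borel_measurable (borel \<Otimes>\<^sub>M N)" for n
      by (intro borel_measurable_divide borel_measurable_diff lh l) simp
  qed
qed

section \<open>Integration over independent sub-sigma-algebras\<close>

context prob_space
begin

text \<open>The identity, read as a random variable into each sub-sigma-algebra, turns independent
  sigma-algebras into independent variables, for which joint laws are products.\<close>

lemma indep_var_id_subalgebras:
  assumes F: "space F = space M" "sets F \<subseteq> events" and G: "space G = space M" "sets G \<subseteq> events"
    and indep: "indep_set (sets F) (sets G)"
  shows "indep_var F (\<lambda>x. x) G (\<lambda>x. x)"
proof -
  have mF: "(\<lambda>x. x) \<in> measurable M F" and mG: "(\<lambda>x. x) \<in> measurable M G"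
    using F G by (auto simp: measurable_def dest: sets.sets_into_space intro: Int_absorb2[THEN ssubst])
  have gen: "sigma_sets (space M) {A \<inter> space M |A. A \<in> sets H} = sets H"
    if "space H = space M" for H
  proof -
    have "{A \<inter> space M |A. A \<in> sets H} = sets H"
      using sets.sets_into_space[of _ H] that by (auto simp: Int_absorb2)
    then show ?thesis using sets.sigma_sets_eq[of H] that by simp
  qed
  show ?thesis
    unfolding indep_var_eq using mF mG indep by (simp add: gen F G)
qed

text \<open>By independence the law of the diagonal map is a product measure, and Tonelli separates
  the two copies. This is the freezing principle: the \<open>F\<close>-measurable argument is held
  fixed while the \<open>G\<close>-measurable one is averaged.\<close>

lemma nn_integral_diagonal_indep:
  assumes F: "space F = space M" "sets F \<subseteq> events" and G: "space G = space M" "sets G \<subseteq> events"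
    and indep: "indep_set (sets F) (sets G)"
    and h: "h \<in> borel_measurable (F \<Otimes>\<^sub>M G)"
  shows "(\<integral>\<^sup>+\<omega>. h (\<omega>, \<omega>) \<partial>M) = (\<integral>\<^sup>+\<omega>. (\<integral>\<^sup>+\<omega>'. h (\<omega>, \<omega>') \<partial>M) \<partial>M)"
proof -
  have iv: "indep_var F (\<lambda>x. x) G (\<lambda>x. x)"
    by (rule indep_var_id_subalgebras[OF F G indep])
  then have eq: "distr M F (\<lambda>x. x) \<Otimes>\<^sub>M distr M G (\<lambda>x. x) = distr M (F \<Otimes>\<^sub>M G) (\<lambda>x. (x, x))"
    by (simp add: indep_var_distribution_eq)
  have mF: "(\<lambda>x. x) \<in> measurable M F" and mG: "(\<lambda>x. x) \<in> measurable M G"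
    using iv by (auto dest: indep_var_rv1 indep_var_rv2)
  interpret DG: prob_space "distr M G (\<lambda>x. x)" by (rule prob_space_distr) (rule mG)
  have h': "h \<in> borel_measurable (distr M F (\<lambda>x. x) \<Otimes>\<^sub>M distr M G (\<lambda>x. x))"
    using h by (simp cong: measurable_cong_sets)
  have sect: "(\<lambda>\<omega>'. h (\<omega>, \<omega>')) \<in> borel_measurable G" if "\<omega> \<in> space M" for \<omega>
    using measurable_compose[OF measurable_Pair1' h] that F by simp
  have "(\<integral>\<^sup>+\<omega>. h (\<omega>, \<omega>) \<partial>M) = (\<integral>\<^sup>+z. h z \<partial>distr M (F \<Otimes>\<^sub>M G) (\<lambda>x. (x, x)))"
    using h mF mG by (subst nn_integral_distr) auto
  also have "\<dots> = (\<integral>\<^sup>+\<omega>. (\<integral>\<^sup>+\<omega>'. h (\<omega>, \<omega>') \<partial>distr M G (\<lambda>x. x)) \<partial>distr M F (\<lambda>x. x))"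
    unfolding eq[symmetric] by (rule DG.nn_integral_fst[OF h', symmetric])
  also have "\<dots> = (\<integral>\<^sup>+\<omega>. (\<integral>\<^sup>+\<omega>'. h (\<omega>, \<omega>') \<partial>distr M G (\<lambda>x. x)) \<partial>M)"
    using DG.borel_measurable_nn_integral_fst[OF h'] by (intro nn_integral_distr mF) simp
  also have "\<dots> = (\<integral>\<^sup>+\<omega>. (\<integral>\<^sup>+\<omega>'. h (\<omega>, \<omega>') \<partial>M) \<partial>M)"
    by (intro nn_integral_cong nn_integral_distr mG) (simp add: sect)
  finally show ?thesis .
qed

lemma nn_integral_mult_indep:
  fixes f g :: "'a \<Rightarrow> ennreal"
  assumes F: "space F = space M" "sets F \<subseteq> events" and G: "space G = space M" "sets G \<subseteq> events"
    and indep: "indep_set (sets F) (sets G)"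
    and f: "f \<in> borel_measurable F" and g: "g \<in> borel_measurable G"
  shows "(\<integral>\<^sup>+\<omega>. f \<omega> * g \<omega> \<partial>M) = (\<integral>\<^sup>+\<omega>. f \<omega> \<partial>M) * (\<integral>\<^sup>+\<omega>. g \<omega> \<partial>M)"
proof -
  have f': "f \<in> borel_measurable M" and g': "g \<in> borel_measurable M"
    using F G f g by (auto simp: measurable_def)
  have "(\<lambda>z. f (fst z) * g (snd z)) \<in> borel_measurable (F \<Otimes>\<^sub>M G)"
    using f g by measurable
  from nn_integral_diagonal_indep[OF F G indep this] show ?thesis
    by (simp add: nn_integral_cmult[OF g'] nn_integral_multc[OF f'])
qed

text \<open>In the expanded square the mixed terms vanish by independence and zero mean, so the
  bound grows linearly in the number of summands.\<close>

lemma nn_integral_norm_sum_centered_le: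
  fixes Y :: "'i \<Rightarrow> 'a \<Rightarrow> 'v::euclidean_space"
  assumes "finite A"
    and int: "\<And>i. i \<in> A \<Longrightarrow> integrable M (Y i)"
    and mean: "\<And>i. i \<in> A \<Longrightarrow> expectation (Y i) = 0"
    and indep: "\<And>i j. i \<in> A \<Longrightarrow> j \<in> A \<Longrightarrow> i \<noteq> j \<Longrightarrow> indep_var borel (Y i) borel (Y j)"
    and bound: "\<And>i. i \<in> A \<Longrightarrow> (\<integral>\<^sup>+\<omega>. ennreal ((norm (Y i \<omega>))\<^sup>2) \<partial>M) \<le> ennreal v"
    and "0 \<le> v"
  shows "(\<integral>\<^sup>+\<omega>. ennreal ((norm (\<Sum>i\<in>A. Y i \<omega>))\<^sup>2) \<partial>M) \<le> ennreal (real (card A) * v)"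
proof -
  have sq: "integrable M (\<lambda>\<omega>. (norm (Y i \<omega>))\<^sup>2)" if "i \<in> A" for i
    using int[OF that] bound[OF that]
    by (intro integrableI_nonneg) (auto intro: le_less_trans)
  have int2: "integrable M (\<lambda>\<omega>. inner (Y i \<omega>) (Y j \<omega>))" if "i \<in> A" "j \<in> A" for i j
  proof (rule Bochner_Integration.integrable_bound)
    show "integrable M (\<lambda>\<omega>. (norm (Y i \<omega>))\<^sup>2 + (norm (Y j \<omega>))\<^sup>2)"
      using sq that by simp
    show "(\<lambda>\<omega>. inner (Y i \<omega>) (Y j \<omega>)) \<in> borel_measurable M"
      using int[OF that(1)] int[OF that(2)] by (intro borel_measurable_inner) auto
    have "\<bar>inner x y\<bar> \<le> (norm x)\<^sup>2 + (norm y)\<^sup>2" for x y :: 'v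
    proof -
      have "0 \<le> (norm x - norm y)\<^sup>2 + (norm x)\<^sup>2 + (norm y)\<^sup>2" by simp
      then have "norm x * norm y \<le> (norm x)\<^sup>2 + (norm y)\<^sup>2"
        by (simp add: power2_eq_square algebra_simps)
      then show ?thesis using Cauchy_Schwarz_ineq2[of x y] by linarith
    qed
    then show "AE \<omega> in M. norm (inner (Y i \<omega>) (Y j \<omega>)) \<le> norm ((norm (Y i \<omega>))\<^sup>2 + (norm (Y j \<omega>))\<^sup>2)"
      by simp
  qed
  have cross: "expectation (\<lambda>\<omega>. inner (Y i \<omega>) (Y j \<omega>)) = 0" if ij: "i \<in> A" "j \<in> A" "i \<noteq> j" for i j
  proof -
    \<comment> \<open>The product rule is used for real coordinates; the inner product is
      reassembled over \<open>Basis\<close> afterwards.\<close>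
    have prod: "expectation (\<lambda>\<omega>. inner (Y i \<omega>) b * inner (Y j \<omega>) b) = 0
        \<and> integrable M (\<lambda>\<omega>. inner (Y i \<omega>) b * inner (Y j \<omega>) b)" for b
    proof -
      have ind: "indep_var borel (\<lambda>\<omega>. inner (Y i \<omega>) b) borel (\<lambda>\<omega>. inner (Y j \<omega>) b)"
        using indep_var_compose[OF indep[OF ij], of "\<lambda>x. inner x b" borel "\<lambda>x. inner x b" borel]
        by (simp add: comp_def)
      have "integrable M (\<lambda>\<omega>. inner (Y i \<omega>) b)" "integrable M (\<lambda>\<omega>. inner (Y j \<omega>) b)"
        using int ij by auto
      from indep_var_lebesgue_integral[OF ind this] indep_var_integrable[OF ind this]
      show ?thesis using mean[OF ij(1)] int[OF ij(1)] by simp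
    qed
    have "expectation (\<lambda>\<omega>. inner (Y i \<omega>) (Y j \<omega>))
        = expectation (\<lambda>\<omega>. \<Sum>b\<in>Basis. inner (Y i \<omega>) b * inner (Y j \<omega>) b)"
      by (subst euclidean_inner) simp
    also have "\<dots> = 0" using prod by (subst Bochner_Integration.integral_sum) auto
    finally show ?thesis .
  qed
  have diag: "expectation (\<lambda>\<omega>. inner (Y i \<omega>) (Y i \<omega>)) \<le> v" if "i \<in> A" for i
  proof -
    have "ennreal (expectation (\<lambda>\<omega>. (norm (Y i \<omega>))\<^sup>2)) \<le> ennreal v"
      using bound[OF that] by (subst nn_integral_eq_integral[OF sq[OF that], symmetric]) auto
    then show ?thesis using \<open>0 \<le> v\<close> by (simp add: dot_square_norm)
  qed
  have expand: "(norm (\<Sum>i\<in>A. Y i \<omega>))\<^sup>2 = (\<Sum>i\<in>A. \<Sum>j\<in>A. inner (Y i \<omega>) (Y j \<omega>))" for \<omega>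
    by (simp add: dot_square_norm[symmetric] inner_sum_left inner_sum_right inner_commute)
  have "(\<integral>\<^sup>+\<omega>. ennreal ((norm (\<Sum>i\<in>A. Y i \<omega>))\<^sup>2) \<partial>M)
      = ennreal (expectation (\<lambda>\<omega>. (norm (\<Sum>i\<in>A. Y i \<omega>))\<^sup>2))"
  proof (rule nn_integral_eq_integral)
    show "integrable M (\<lambda>\<omega>. (norm (\<Sum>i\<in>A. Y i \<omega>))\<^sup>2)"
      unfolding expand using int2 by auto
  qed simp
  also have "expectation (\<lambda>\<omega>. (norm (\<Sum>i\<in>A. Y i \<omega>))\<^sup>2)
      = (\<Sum>i\<in>A. \<Sum>j\<in>A. expectation (\<lambda>\<omega>. inner (Y i \<omega>) (Y j \<omega>)))"
    using int2 by (simp add: expand Bochner_Integration.integral_sum)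
  also have "\<dots> = (\<Sum>i\<in>A. \<Sum>j\<in>A. if i = j then expectation (\<lambda>\<omega>. inner (Y i \<omega>) (Y i \<omega>)) else 0)"
    by (intro sum.cong) (auto simp: cross)
  also have "\<dots> \<le> (\<Sum>i\<in>A. v)"
    using \<open>finite A\<close> diag by (intro sum_mono) simp
  finally show ?thesis by (simp add: ennreal_leI)
qed

end

section \<open>Pi-systems, ordered products and the geometric rate\<close>

lemma Int_stable_vimages: "Int_stable {f -` A \<inter> S |A. A \<in> sets N}"
proof (rule Int_stableI)
  fix a b assume "a \<in> {f -` A \<inter> S |A. A \<in> sets N}" "b \<in> {f -` A \<inter> S |A. A \<in> sets N}"
  then obtain A B where "A \<in> sets N" "B \<in> sets N" "a \<inter> b = f -` (A \<inter> B) \<inter> S" by blast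
  then show "a \<inter> b \<in> {f -` A \<inter> S |A. A \<in> sets N}" by blast
qed

lemma ordered_prod_refl [simp]: "ordered_prod A j j = mat 1"
  by (simp add: ordered_prod_def)

text \<open>The product grows at its right end, so a row vector in front of it gains one factor per
  iteration.\<close>

lemma ordered_prod_Suc:
  assumes "j \<le> t"
  shows "ordered_prod A j (Suc t) = ordered_prod A j t ** A (Suc t)"
proof -
  \<comment> \<open>The new factor replaces the identity at the end of the fold, hence the
    generalisation to any end value \<open>B\<close>.\<close>
  have foldr_mult: "foldr (**) xs B = foldr (**) xs (mat 1) ** B" for xs and B :: "real^'n^'n"
    by (induction xs) (simp_all add: matrix_mul_assoc[symmetric])
  have upt: "[Suc j..<Suc (Suc t)] = [Suc j..<Suc t] @ [Suc t]"
    using assms by simp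
  have "ordered_prod A j (Suc t) = foldr (**) (map A [Suc j..<Suc t]) (A (Suc t))"
    unfolding ordered_prod_def upt by (simp del: upt_Suc)
  also have "\<dots> = ordered_prod A j t ** A (Suc t)"
    unfolding ordered_prod_def by (rule foldr_mult)
  finally show ?thesis .
qed

text \<open>The expression inside the square simplifies to \<open>1 / (2 * real n - 1)\<close>,
  which lies in the interval from 0 (excluded) to 1.\<close>

lemma contraction_rate_bounds:
  assumes "n \<ge> 1"
  shows "0 \<le> contraction_rate n" "contraction_rate n < 1"
proof -
  define d where "d = 1 / (2 * real n - 1)"
  have "0 < d" "d \<le> 1" using assms by (auto simp: d_def)
  moreover have "contraction_rate n = 1 - d\<^sup>2"
    using assms by (simp add: contraction_rate_def d_def field_simps)
  ultimately show "0 \<le> contraction_rate n" "contraction_rate n < 1"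
    by (simp_all add: power_le_one)
qed

lemma sum_geometric_le:
  fixes x :: real
  assumes "0 \<le> x" "x < 1"
  shows "(\<Sum>j=0..t. x ^ (t - j)) \<le> 1 / (1 - x)"
proof -
  have "(\<Sum>j=0..t. x ^ (t - j)) = (\<Sum>j<Suc t. x ^ j)"
    by (subst sum.atLeastAtMost_rev) (simp add: atLeast0AtMost lessThan_Suc_atMost)
  also have "\<dots> = (1 - x ^ Suc t) / (1 - x)"
    unfolding sum_gp_strict using assms by simp
  also have "\<dots> \<le> 1 / (1 - x)" using assms by (intro divide_right_mono) auto
  finally show ?thesis .
qed

section \<open>The SWIFT process\<close>

locale swift = prob_space P
  for P :: "'w measure" +
  fixes p :: "'n::finite \<Rightarrow> real" and w :: "nat \<Rightarrow> 'n \<Rightarrow> real^'n"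
    and D :: "'n \<Rightarrow> 'b measure" and l :: "real^'d::finite \<Rightarrow> 'b \<Rightarrow> real"
    and L \<sigma> \<zeta> :: real
    and act :: "nat \<Rightarrow> 'w \<Rightarrow> 'n" and smp :: "'n \<Rightarrow> nat \<Rightarrow> nat \<Rightarrow> 'w \<Rightarrow> 'b"
    and M :: nat and \<gamma> :: real and x0 :: "real^'d" and s T :: nat
  assumes scores: "scores p"
    and guarantee: "\<And>q. ccs_guarantee p (w q)"
    and standing: "standing_assumptions p D l L \<sigma> \<zeta>"
    and M_pos: "M > 0"
    and sampling: "swift_sampling P p D M act smp"
begin

section \<open>Sigma-algebras generated by sets of draws\<close>

definition draw_sets :: "nat + 'n \<times> nat \<times> nat \<Rightarrow> 'w set set" where
  "draw_sets v = (case v of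
      Inl t \<Rightarrow> {act t -` A \<inter> space P | A. A \<in> sets (count_space UNIV)}
    | Inr (k, t, m) \<Rightarrow> {smp k t m -` A \<inter> space P | A. A \<in> sets (D k)})"

definition draws :: "(nat + 'n \<times> nat \<times> nat) set" where
  "draws = range Inl \<union> Inr ` (UNIV \<times> UNIV \<times> {1..M})"

text \<open>The information carried by the draws in \<open>J\<close>; independence thereby reduces
  to disjointness of index sets.\<close>

definition generated :: "(nat + 'n \<times> nat \<times> nat) set \<Rightarrow> 'w measure" where
  "generated J = sigma (space P) (\<Union>v\<in>J. draw_sets v)"

text \<open>Draws strictly before iteration \<open>t\<close>: they determine the models at time
  \<open>t\<close>, while \<open>act t\<close> and the batches of iteration \<open>t\<close> stay
  outside.\<close>

definition history :: "nat \<Rightarrow> (nat + 'n \<times> nat \<times> nat) set" where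
  "history t = Inl ` {..<t} \<union> Inr ` (UNIV \<times> {..<t} \<times> {1..M})"

definition batch :: "'n \<Rightarrow> nat \<Rightarrow> (nat + 'n \<times> nat \<times> nat) set" where
  "batch k t = (\<lambda>m. Inr (k, t, m)) ` {1..M}"

lemma draw_sets_Pow: "draw_sets v \<subseteq> Pow (space P)"
  by (auto simp: draw_sets_def split: sum.splits)

lemma space_generated [simp]: "space (generated J) = space P"
  unfolding generated_def using draw_sets_Pow by (intro space_measure_of) auto

lemma sets_generated: "sets (generated J) = sigma_sets (space P) (\<Union>v\<in>J. draw_sets v)"
  unfolding generated_def using draw_sets_Pow by (intro sets_measure_of) auto

lemma sets_generated_mono: "J \<subseteq> K \<Longrightarrow> sets (generated J) \<subseteq> sets (generated K)"
  unfolding sets_generated by (intro sigma_sets_subseteq) auto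

lemma measurable_generated_mono:
  "f \<in> measurable (generated J) N \<Longrightarrow> J \<subseteq> K \<Longrightarrow> f \<in> measurable (generated K) N"
  using sets_generated_mono[of J K] by (auto simp: measurable_def)

lemma indep_draws: "indep_sets draw_sets draws"
  using sampling unfolding swift_sampling_def draw_sets_def[abs_def] draws_def by blast

lemma sets_generated_subset: "J \<subseteq> draws \<Longrightarrow> sets (generated J) \<subseteq> events"
proof -
  assume "J \<subseteq> draws"
  then have "(\<Union>v\<in>J. draw_sets v) \<subseteq> events"
    using indep_draws by (auto simp: indep_sets_def)
  then show ?thesis unfolding sets_generated by (rule sets.sigma_sets_subset)
qed

lemma measurable_from_generated:
  "f \<in> measurable (generated J) N \<Longrightarrow> J \<subseteq> draws \<Longrightarrow> f \<in> measurable P N"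
  using sets_generated_subset[of J] by (auto simp: measurable_def)

text \<open>Disjoint blocks of an independent family of pi-systems generate independent
  sigma-algebras; \<open>case_bool\<close> packs the two blocks into one indexed family.\<close>

lemma indep_generated:
  assumes "J \<subseteq> draws" "K \<subseteq> draws" "J \<inter> K = {}"
  shows "indep_set (sets (generated J)) (sets (generated K))"
proof -
  have "indep_sets (\<lambda>b. sigma_sets (space P) (\<Union>v\<in>case_bool J K b. draw_sets v)) UNIV"
  proof (rule indep_sets_collect_sigma)
    show "indep_sets draw_sets (\<Union>b\<in>UNIV. case_bool J K b)"
      by (rule indep_sets_mono_index[OF _ indep_draws]) (use assms in \<open>auto simp: UNIV_bool\<close>)
    show "disjoint_family_on (case_bool J K) UNIV"
      using assms by (auto simp: disjoint_family_on_def split: bool.splits)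
    show "Int_stable (draw_sets v)" for v
      by (auto simp only: draw_sets_def Int_stable_vimages split: sum.split prod.split)
  qed
  moreover have "(\<lambda>b. sigma_sets (space P) (\<Union>v\<in>case_bool J K b. draw_sets v))
      = case_bool (sets (generated J)) (sets (generated K))"
    by (auto simp: sets_generated split: bool.splits)
  ultimately show ?thesis by (simp add: indep_set_def)
qed

lemma indep_var_generated:
  assumes "J \<subseteq> draws" "K \<subseteq> draws" "J \<inter> K = {}"
    and "f \<in> measurable (generated J) N" "g \<in> measurable (generated K) N'"
  shows "indep_var N f N' g"
  using indep_var_compose[OF indep_var_id_subalgebras[OF _ _ _ _ indep_generated[OF assms(1-3)]] assms(4,5)]
    sets_generated_subset assms(1,2) by (simp add: comp_def)

lemma act_measurable_generated [measurable (raw)]: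
  "Inl t \<in> J \<Longrightarrow> act t \<in> measurable (generated J) (count_space UNIV)"
proof (rule measurableI)
  fix A assume "Inl t \<in> J"
  have "act t -` A \<inter> space P \<in> draw_sets (Inl t)"
    by (auto simp: draw_sets_def)
  then show "act t -` A \<inter> space (generated J) \<in> sets (generated J)"
    unfolding space_generated sets_generated using \<open>Inl t \<in> J\<close> by (intro sigma_sets.Basic) blast
qed simp

lemma smp_measurable: "m \<in> {1..M} \<Longrightarrow> smp k t m \<in> measurable P (D k)"
  and smp_distr: "m \<in> {1..M} \<Longrightarrow> distr P (D k) (smp k t m) = D k"
  and prob_act: "prob {\<omega> \<in> space P. act t \<omega> = i} = p i"
  using sampling by (auto simp: swift_sampling_def)

lemma smp_measurable_generated:
  assumes "m \<in> {1..M}" "Inr (k, t, m) \<in> J"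
  shows "smp k t m \<in> measurable (generated J) (D k)"
proof (rule measurableI)
  fix A assume "A \<in> sets (D k)"
  then have "smp k t m -` A \<inter> space P \<in> draw_sets (Inr (k, t, m))"
    by (auto simp: draw_sets_def)
  then show "smp k t m -` A \<inter> space (generated J) \<in> sets (generated J)"
    unfolding space_generated sets_generated using assms(2) by (intro sigma_sets.Basic) blast
qed (use measurable_space[OF smp_measurable[OF assms(1)]] in auto)

section \<open>Measurability of the iterates with respect to the history\<close>

abbreviation loc_grad :: "'n \<Rightarrow> real^'d \<Rightarrow> real^'d" where
  "loc_grad k \<equiv> grad (local_obj D l k)"

abbreviation smp_grad :: "'b \<Rightarrow> real^'d \<Rightarrow> real^'d" where
  "smp_grad \<xi> \<equiv> grad (\<lambda>y. l y \<xi>)"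

abbreviation "X \<omega> \<equiv> models l M \<gamma> x0 s T w (\<lambda>q. act q \<omega>) (\<lambda>k q m. smp k q m \<omega>)"

abbreviation "\<Delta> \<omega> q \<equiv> comm_mat s T w (\<lambda>q. act q \<omega>) q - expected_comm p (w q)"

lemma loc_grad_measurable: "loc_grad k \<in> borel_measurable borel"
  using standing unfolding standing_assumptions_def
  by (auto intro!: borel_measurable_continuous_onI intro: lipschitz_on_continuous_on)

lemma smp_grad_measurable: "(\<lambda>z. smp_grad (snd z) (fst z)) \<in> borel_measurable (borel \<Otimes>\<^sub>M D k)"
  using standing unfolding standing_assumptions_def
  by (intro borel_measurable_grad_pair) auto

lemma smp_grad_compose_measurable:
  assumes "x \<in> borel_measurable N" "y \<in> measurable N (D k)"
  shows "(\<lambda>\<omega>. smp_grad (y \<omega>) (x \<omega>)) \<in> borel_measurable N"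
  using measurable_compose[OF measurable_Pair[OF assms] smp_grad_measurable] by simp

lemma batch_grad_measurable:
  assumes "x \<in> borel_measurable (generated J)" "batch k t \<subseteq> J"
  shows "(\<lambda>\<omega>. batch_grad l M (\<lambda>m. smp k t m \<omega>) (x \<omega>)) \<in> borel_measurable (generated J)"
  unfolding batch_grad_def using assms
  by (intro borel_measurable_scaleR borel_measurable_const borel_measurable_sum
      smp_grad_compose_measurable[where k=k] smp_measurable_generated) (auto simp: batch_def)

lemma counter_measurable:
  "Inl ` {..<t} \<subseteq> J \<Longrightarrow>
    (\<lambda>\<omega>. counter (\<lambda>q. act q \<omega>) t k) \<in> measurable (generated J) (count_space UNIV)"
proof (induction t)
  case (Suc t)
  have [measurable]: "act t \<in> measurable (generated J) (count_space UNIV)"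
    using Suc.prems by (intro act_measurable_generated) auto
  have [measurable]: "(\<lambda>\<omega>. counter (\<lambda>q. act q \<omega>) t k) \<in> measurable (generated J) (count_space UNIV)"
    using Suc.prems by (intro Suc.IH) auto
  show ?case by simp
qed simp

text \<open>The clients that would communicate if they were active at iteration \<open>t\<close>.
  Asking this of every client makes the set a function of the past, independent of
  \<open>act t\<close>.\<close>

definition comm_clients :: "nat \<Rightarrow> 'w \<Rightarrow> 'n set" where
  "comm_clients t \<omega> = {k. counter (\<lambda>q. act q \<omega>) t k \<in> comm_set s T}"

lemma \<Delta>_eq_comm_step: "\<Delta> \<omega> t = comm_step p (w t) (comm_clients t \<omega>) (act t \<omega>)"
  by (simp add: comm_mat_def comm_step_def comm_clients_def)

lemma comm_step_measurable:
  assumes "Inl ` {..<t} \<subseteq> J"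
  shows "(\<lambda>\<omega>. comm_step p (w t) (comm_clients t \<omega>) k $ r $ c) \<in> borel_measurable (generated J)"
proof -
  note counter_measurable[OF assms, measurable]
  \<comment> \<open>The random set matters only through membership of \<open>k\<close>, so the entry
    takes just two constant values, represented by \<open>UNIV\<close> and
    \<open>{}\<close>.\<close>
  have "(\<lambda>\<omega>. if counter (\<lambda>q. act q \<omega>) t k \<in> comm_set s T
      then comm_step p (w t) UNIV k $ r $ c else comm_step p (w t) {} k $ r $ c)
      \<in> borel_measurable (generated J)" by measurable
  also have "(\<lambda>\<omega>. if counter (\<lambda>q. act q \<omega>) t k \<in> comm_set s T
      then comm_step p (w t) UNIV k $ r $ c else comm_step p (w t) {} k $ r $ c)
      = (\<lambda>\<omega>. comm_step p (w t) (comm_clients t \<omega>) k $ r $ c)"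
    by (auto simp: comm_step_def comm_clients_def)
  finally show ?thesis .
qed

lemma measurable_at_act:
  assumes "\<And>k. f k \<in> borel_measurable (generated J)" "Inl t \<in> J"
  shows "(\<lambda>\<omega>. f (act t \<omega>) \<omega>) \<in> borel_measurable (generated J)"
  by (rule measurable_compose_countable'[where I=UNIV])
    (use assms in \<open>auto intro: act_measurable_generated countable_finite\<close>)

lemma \<Delta>_measurable:
  assumes "Inl ` {..t} \<subseteq> J"
  shows "(\<lambda>\<omega>. \<Delta> \<omega> t $ r $ c) \<in> borel_measurable (generated J)"
  unfolding \<Delta>_eq_comm_step
  by (rule measurable_at_act[OF comm_step_measurable]) (use assms in auto)

lemma history_Suc:
  "history t \<subseteq> history (Suc t)" "Inl t \<in> history (Suc t)" "batch k t \<subseteq> history (Suc t)"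
  "Inl ` {..<t} \<subseteq> history t" "Inl ` {..t} \<subseteq> history (Suc t)"
  by (auto simp: history_def batch_def)

lemma history_mono: "t \<le> u \<Longrightarrow> history t \<subseteq> history u"
  by (force simp: history_def)

lemma draws_subsets: "history t \<subseteq> draws" "insert (Inl t) (history t) \<subseteq> draws" "batch k t \<subseteq> draws"
  "{Inl t} \<subseteq> draws"
  by (auto simp: history_def draws_def batch_def)

lemma X_measurable: "(\<lambda>\<omega>. X \<omega> t $ r $ c) \<in> borel_measurable (generated (history t))"
proof (induction t arbitrary: r c)
  case (Suc t)
  let ?H = "history (Suc t)"
  have X: "(\<lambda>\<omega>. X \<omega> t $ r $ c) \<in> borel_measurable (generated ?H)" for r c
    by (rule measurable_generated_mono[OF Suc.IH history_Suc(1)])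
  \<comment> \<open>The communication matrix is the centred one plus its deterministic mean.\<close>
  have W: "(\<lambda>\<omega>. comm_mat s T w (\<lambda>q. act q \<omega>) t $ r $ c) \<in> borel_measurable (generated ?H)" for r c
    using borel_measurable_add[OF \<Delta>_measurable[OF history_Suc(5)] borel_measurable_const,
        of t r c "expected_comm p (w t) $ r $ c"] by simp
  have "(\<lambda>\<omega>. grad_mat l M (\<lambda>q. act q \<omega>) (\<lambda>k q m. smp k q m \<omega>) t (X \<omega> t) $ r $ c)
      \<in> borel_measurable (generated ?H)"
  proof -
    have "(\<lambda>\<omega>. column c (X \<omega> t)) \<in> borel_measurable (generated ?H)"
      using X by (simp add: borel_measurable_vec_iff column_def)
    then have "(\<lambda>\<omega>. batch_grad l M (\<lambda>m. smp c t m \<omega>) (column c (X \<omega> t))) \<in> borel_measurable (generated ?H)"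
      by (rule batch_grad_measurable[OF _ history_Suc(3)])
    then have [measurable]: "(\<lambda>\<omega>. batch_grad l M (\<lambda>m. smp c t m \<omega>) (column c (X \<omega> t)) $ r)
        \<in> borel_measurable (generated ?H)"
      by (simp add: borel_measurable_vec_iff)
    note act_measurable_generated[OF history_Suc(2), measurable]
    \<comment> \<open>Where entry \<open>c\<close> can be nonzero, the active client is
      \<open>c\<close>, so the random index is replaced by the fixed one.\<close>
    have "(\<lambda>\<omega>. if c = act t \<omega> then batch_grad l M (\<lambda>m. smp c t m \<omega>) (column c (X \<omega> t)) $ r else 0)
        \<in> borel_measurable (generated ?H)" by measurable
    also have "(\<lambda>\<omega>. if c = act t \<omega> then batch_grad l M (\<lambda>m. smp c t m \<omega>) (column c (X \<omega> t)) $ r else 0)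
        = (\<lambda>\<omega>. grad_mat l M (\<lambda>q. act q \<omega>) (\<lambda>k q m. smp k q m \<omega>) t (X \<omega> t) $ r $ c)"
      by (auto simp: grad_mat_def)
    finally show ?thesis .
  qed
  then show ?case
    using X W by (auto simp: matrix_matrix_mult_def)
qed simp

lemma column_X_measurable: "(\<lambda>\<omega>. column k (X \<omega> t)) \<in> borel_measurable (generated (history t))"
  using X_measurable by (simp add: borel_measurable_vec_iff column_def)

section \<open>Squared gradients, the row process and mini-batch variance\<close>

definition true_grad_sq :: "nat \<Rightarrow> 'w \<Rightarrow> real" where
  "true_grad_sq j \<omega> = (norm (loc_grad (act j \<omega>) (column (act j \<omega>) (X \<omega> j))))\<^sup>2"

definition batch_grad_sq :: "nat \<Rightarrow> 'w \<Rightarrow> real" where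
  "batch_grad_sq j \<omega> =
     (norm (batch_grad l M (\<lambda>m. smp (act j \<omega>) j m \<omega>) (column (act j \<omega>) (X \<omega> j))))\<^sup>2"

text \<open>The row of the ordered product at the client active in iteration \<open>j\<close>, which
  is the one met by the nonzero column of the gradient matrix.\<close>

definition comm_row :: "nat \<Rightarrow> nat \<Rightarrow> 'w \<Rightarrow> real^'n" where
  "comm_row j t \<omega> = axis (act j \<omega>) 1 v* ordered_prod (\<Delta> \<omega>) j t"

lemma true_grad_sq_measurable: "true_grad_sq j \<in> borel_measurable (generated (history (Suc j)))"
  unfolding true_grad_sq_def
  by (rule measurable_at_act[OF _ history_Suc(2)])
    (intro borel_measurable_power measurable_compose[OF _ borel_measurable_norm]
      measurable_compose[OF _ loc_grad_measurable]
      measurable_generated_mono[OF column_X_measurable history_Suc(1)])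

lemma batch_grad_sq_measurable: "batch_grad_sq j \<in> borel_measurable (generated (history (Suc j)))"
  unfolding batch_grad_sq_def
  by (rule measurable_at_act[OF _ history_Suc(2)])
    (intro borel_measurable_power measurable_compose[OF _ borel_measurable_norm]
      batch_grad_measurable history_Suc
      measurable_generated_mono[OF column_X_measurable history_Suc(1)])

text \<open>For a fixed model \<open>x\<close> the \<open>M\<close> sample errors are independent,
  centred and of second moment at most \<open>\<sigma>\<^sup>2\<close>. Their sum contributes a
  factor \<open>M\<close>, the averaging a factor \<open>1 / M\<^sup>2\<close>.\<close>

lemma batch_grad_variance:
  "(\<integral>\<^sup>+\<omega>. ennreal ((norm (batch_grad l M (\<lambda>m. smp k t m \<omega>) x - loc_grad k x))\<^sup>2) \<partial>P)
    \<le> ennreal (\<sigma>\<^sup>2 / real M)"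
proof -
  define Y where "Y m \<omega> = smp_grad (smp k t m \<omega>) x - loc_grad k x" for m \<omega>
  have hb: "has_bochner_integral (D k) (\<lambda>\<xi>. smp_grad \<xi> x) (loc_grad k x)"
    and var: "(\<integral>\<^sup>+\<xi>. ennreal ((norm (loc_grad k x - smp_grad \<xi> x))\<^sup>2) \<partial>D k) \<le> ennreal (\<sigma>\<^sup>2)"
    using standing unfolding standing_assumptions_def by auto
  have m: "(\<lambda>\<xi>. smp_grad \<xi> x) \<in> borel_measurable (D k)"
    using hb by (auto dest: borel_measurable_has_bochner_integral)
  have int: "integrable P (\<lambda>\<omega>. smp_grad (smp k t m \<omega>) x)"
    and mean: "expectation (\<lambda>\<omega>. smp_grad (smp k t m \<omega>) x) = loc_grad k x" if "m \<in> {1..M}" for m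
  proof -
    show "integrable P (\<lambda>\<omega>. smp_grad (smp k t m \<omega>) x)"
      using integrable_distr_eq[OF smp_measurable[OF that] m, of t] hb
      by (auto simp: smp_distr[OF that] has_bochner_integral_iff)
    show "expectation (\<lambda>\<omega>. smp_grad (smp k t m \<omega>) x) = loc_grad k x"
      using integral_distr[OF smp_measurable[OF that] m, of t] hb
      by (auto simp: smp_distr[OF that] has_bochner_integral_iff)
  qed
  have sum: "(\<integral>\<^sup>+\<omega>. ennreal ((norm (\<Sum>m\<in>{1..M}. Y m \<omega>))\<^sup>2) \<partial>P) \<le> ennreal (real (card {1..M}) * \<sigma>\<^sup>2)"
  proof (rule nn_integral_norm_sum_centered_le)
    show "integrable P (Y i)" if "i \<in> {1..M}" for i
      unfolding Y_def using int[OF that] by simp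
    show "expectation (Y i) = 0" if "i \<in> {1..M}" for i
      unfolding Y_def using int[OF that] mean[OF that] by (simp add: prob_space)
    show "indep_var borel (Y i) borel (Y j)" if "i \<in> {1..M}" "j \<in> {1..M}" "i \<noteq> j" for i j
    proof (rule indep_var_generated)
      have "Y m \<in> borel_measurable (generated {Inr (k, t, m)})" if "m \<in> {1..M}" for m
        unfolding Y_def
        by (intro borel_measurable_diff borel_measurable_const
            measurable_compose[OF smp_measurable_generated m]) (use that in auto)
      then show "Y i \<in> borel_measurable (generated {Inr (k, t, i)})"
        "Y j \<in> borel_measurable (generated {Inr (k, t, j)})"
        using that by auto
    qed (use that in \<open>auto simp: draws_def\<close>)
    show "(\<integral>\<^sup>+\<omega>. ennreal ((norm (Y i \<omega>))\<^sup>2) \<partial>P) \<le> ennreal (\<sigma>\<^sup>2)" if "i \<in> {1..M}" for i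
    proof -
      have "(\<integral>\<^sup>+\<omega>. ennreal ((norm (Y i \<omega>))\<^sup>2) \<partial>P)
          = (\<integral>\<^sup>+\<xi>. ennreal ((norm (smp_grad \<xi> x - loc_grad k x))\<^sup>2) \<partial>distr P (D k) (smp k t i))"
        unfolding Y_def
        by (intro nn_integral_distr[symmetric] smp_measurable[OF that] measurable_compose[OF _ measurable_ennreal]
            borel_measurable_power measurable_compose[OF _ borel_measurable_norm]
            borel_measurable_diff borel_measurable_const) (simp add: m)
      then show ?thesis using var by (simp add: smp_distr[OF that] norm_minus_commute)
    qed
  qed auto
  have batch: "batch_grad l M (\<lambda>m. smp k t m \<omega>) x - loc_grad k x = (1 / real M) *\<^sub>R (\<Sum>m\<in>{1..M}. Y m \<omega>)" for \<omega>
    using M_pos by (simp add: batch_grad_def Y_def sum_subtractf scaleR_diff_right sum_constant_scaleR del: sum_constant)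
  have "(\<integral>\<^sup>+\<omega>. ennreal ((norm (batch_grad l M (\<lambda>m. smp k t m \<omega>) x - loc_grad k x))\<^sup>2) \<partial>P)
      = (\<integral>\<^sup>+\<omega>. ennreal ((1 / real M)\<^sup>2) * ennreal ((norm (\<Sum>m\<in>{1..M}. Y m \<omega>))\<^sup>2) \<partial>P)"
    unfolding batch by (simp add: power_mult_distrib ennreal_mult[symmetric] power_divide)
  also have "\<dots> = ennreal ((1 / real M)\<^sup>2) * (\<integral>\<^sup>+\<omega>. ennreal ((norm (\<Sum>m\<in>{1..M}. Y m \<omega>))\<^sup>2) \<partial>P)"
    using int by (intro nn_integral_cmult) (auto simp: Y_def intro!: borel_measurable_sum borel_measurable_diff)
  also have "\<dots> \<le> ennreal ((1 / real M)\<^sup>2) * ennreal (real (card {1..M}) * \<sigma>\<^sup>2)"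
    by (intro mult_left_mono sum) simp
  also have "\<dots> = ennreal (\<sigma>\<^sup>2 / real M)"
  proof -
    have "(1 / real M)\<^sup>2 * (real (card {1..M}) * \<sigma>\<^sup>2) = \<sigma>\<^sup>2 / real M"
      using M_pos by (simp add: power2_eq_square)
    then show ?thesis by (subst ennreal_mult[symmetric]) simp_all
  qed
  finally show ?thesis .
qed

lemma comm_row_refl: "comm_row j j \<omega> = axis (act j \<omega>) 1"
  by (simp add: comm_row_def)

lemma comm_row_Suc: "j \<le> t \<Longrightarrow> comm_row j (Suc t) \<omega> = comm_row j t \<omega> v* \<Delta> \<omega> (Suc t)"
  by (simp add: comm_row_def ordered_prod_Suc vector_matrix_mul_assoc)

text \<open>The row at \<open>t\<close> already uses \<open>act t\<close>, hence the history up to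
  \<open>Suc t\<close>; it remains independent of \<open>act (Suc t)\<close>.\<close>

lemma comm_row_measurable:
  "j \<le> t \<Longrightarrow> comm_row j t \<in> borel_measurable (generated (history (Suc t)))"
proof (induction t rule: dec_induct)
  case base
  have "(\<lambda>\<omega>. axis (act j \<omega>) 1 :: real^'n) \<in> borel_measurable (generated (history (Suc j)))"
    by (rule measurable_at_act[where f="\<lambda>k _. axis k 1"]) (auto simp: history_Suc)
  then show ?case by (simp add: comm_row_refl cong: measurable_cong)
next
  case (step t)
  have row: "(\<lambda>\<omega>. comm_row j t \<omega> $ r) \<in> borel_measurable (generated (history (Suc (Suc t))))" for r
    using measurable_generated_mono[OF step.IH history_Suc(1)] by (simp add: borel_measurable_vec_iff)
  have "(\<lambda>\<omega>. (comm_row j t \<omega> v* \<Delta> \<omega> (Suc t)) $ c) \<in> borel_measurable (generated (history (Suc (Suc t))))" for c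
    unfolding vector_matrix_mult_def vec_lambda_beta
    by (intro borel_measurable_sum borel_measurable_times row \<Delta>_measurable history_Suc)
  then show ?case
    using step.hyps by (simp add: borel_measurable_vec_iff comm_row_Suc)
qed

section \<open>Averaging over the active client\<close>

lemma p_nonneg: "0 \<le> p k" and sum_p: "(\<Sum>k\<in>UNIV. p k) = 1"
  using scores by (auto simp: scores_def)

lemma nn_integral_act:
  "(\<integral>\<^sup>+\<omega>. (if act t \<omega> = k then c else 0) \<partial>P) = ennreal (p k) * c"
proof -
  have [measurable]: "act t \<in> measurable P (count_space UNIV)"
    by (rule measurable_from_generated[OF act_measurable_generated draws_subsets(4)]) simp
  have "(\<integral>\<^sup>+\<omega>. (if act t \<omega> = k then c else 0) \<partial>P)
      = (\<integral>\<^sup>+\<omega>. c * indicator {\<omega> \<in> space P. act t \<omega> = k} \<omega> \<partial>P)"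
    by (intro nn_integral_cong) auto
  also have "\<dots> = c * emeasure P {\<omega> \<in> space P. act t \<omega> = k}"
    by (rule nn_integral_cmult_indicator) measurable
  finally show ?thesis by (simp add: emeasure_eq_measure prob_act mult.commute)
qed

text \<open>Splitting over the values of \<open>act t\<close> separates an indicator, independent of
  the history, from a function of the history.\<close>

lemma nn_integral_at_act:
  assumes f: "\<And>k. f k \<in> borel_measurable (generated (history t))"
  shows "(\<integral>\<^sup>+\<omega>. f (act t \<omega>) \<omega> \<partial>P) = (\<integral>\<^sup>+\<omega>. (\<Sum>k\<in>UNIV. ennreal (p k) * f k \<omega>) \<partial>P)"
proof -
  have fP: "f k \<in> borel_measurable P" for k
    by (rule measurable_from_generated[OF f draws_subsets(1)])
  have [measurable]: "act t \<in> measurable (generated {Inl t}) (count_space UNIV)"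
    by (rule act_measurable_generated) simp
  have ind: "(\<lambda>\<omega>. if act t \<omega> = k then 1 else 0 :: ennreal) \<in> borel_measurable (generated {Inl t})" for k
    by measurable
  have "(\<integral>\<^sup>+\<omega>. f (act t \<omega>) \<omega> \<partial>P)
      = (\<integral>\<^sup>+\<omega>. (\<Sum>k\<in>UNIV. (if act t \<omega> = k then 1 else 0) * f k \<omega>) \<partial>P)"
    by (intro nn_integral_cong) (simp add: if_distrib[of "\<lambda>x. x * _"] cong: if_cong)
  also have "\<dots> = (\<Sum>k\<in>UNIV. \<integral>\<^sup>+\<omega>. (if act t \<omega> = k then 1 else 0) * f k \<omega> \<partial>P)"
    by (intro nn_integral_sum borel_measurable_times_ennreal fP
        measurable_from_generated[OF ind draws_subsets(4)])
  also have "\<dots> = (\<Sum>k\<in>UNIV. ennreal (p k) * (\<integral>\<^sup>+\<omega>. f k \<omega> \<partial>P))"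
  proof (intro sum.cong refl)
    fix k
    have "indep_set (sets (generated {Inl t})) (sets (generated (history t)))"
      by (rule indep_generated[OF draws_subsets(4) draws_subsets(1)]) (auto simp: history_def)
    from nn_integral_mult_indep[OF space_generated sets_generated_subset[OF draws_subsets(4)]
        space_generated sets_generated_subset[OF draws_subsets(1)] this ind f]
    have "(\<integral>\<^sup>+\<omega>. (if act t \<omega> = k then 1 else 0) * f k \<omega> \<partial>P)
        = (\<integral>\<^sup>+\<omega>. (if act t \<omega> = k then 1 else 0) \<partial>P) * (\<integral>\<^sup>+\<omega>. f k \<omega> \<partial>P)"
      by simp
    then show "(\<integral>\<^sup>+\<omega>. (if act t \<omega> = k then 1 else 0) * f k \<omega> \<partial>P) = ennreal (p k) * (\<integral>\<^sup>+\<omega>. f k \<omega> \<partial>P)"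
      by (simp add: nn_integral_act)
  qed
  also have "\<dots> = (\<integral>\<^sup>+\<omega>. (\<Sum>k\<in>UNIV. ennreal (p k) * f k \<omega>) \<partial>P)"
    by (subst nn_integral_sum) (auto simp: nn_integral_cmult fP intro!: borel_measurable_times_ennreal)
  finally show ?thesis .
qed

lemma rate_bounds: "0 \<le> contraction_rate CARD('n)" "contraction_rate CARD('n) < 1"
  by (rule contraction_rate_bounds, simp add: Suc_leI)+

text \<open>The weight \<open>batch_grad_sq j\<close> is known before every later choice of client,
  so it is carried along while the one-step contraction is iterated. The row starts as a unit
  vector.\<close>

lemma comm_row_contraction:
  "j \<le> t \<Longrightarrow> (\<integral>\<^sup>+\<omega>. ennreal (batch_grad_sq j \<omega> * (norm (comm_row j t \<omega>))\<^sup>2) \<partial>P)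
    \<le> ennreal (contraction_rate CARD('n) ^ (t - j)) * (\<integral>\<^sup>+\<omega>. ennreal (batch_grad_sq j \<omega>) \<partial>P)"
proof (induction t rule: dec_induct)
  case base
  then show ?case by (simp add: comm_row_refl)
next
  case (step t)
  let ?H = "history (Suc t)"
  define A where "A \<omega> k = comm_step p (w (Suc t)) (comm_clients (Suc t) \<omega>) k" for \<omega> k
  define f where "f k \<omega> = batch_grad_sq j \<omega> * (norm (comm_row j t \<omega> v* A \<omega> k))\<^sup>2" for k \<omega>
  have g0: "0 \<le> batch_grad_sq j \<omega>" for \<omega> by (simp add: batch_grad_sq_def)
  have f0: "0 \<le> f k \<omega>" for k \<omega> by (simp add: f_def g0)
  have g: "batch_grad_sq j \<in> borel_measurable (generated ?H)"
    by (rule measurable_generated_mono[OF batch_grad_sq_measurable history_mono]) (use step.hyps in simp)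
  have row: "comm_row j t \<in> borel_measurable (generated ?H)"
    by (rule comm_row_measurable) (use step.hyps in simp)
  have f: "f k \<in> borel_measurable (generated ?H)" for k
  proof -
    have "(\<lambda>\<omega>. (comm_row j t \<omega> v* A \<omega> k) $ c) \<in> borel_measurable (generated ?H)" for c
      unfolding vector_matrix_mult_def vec_lambda_beta A_def
      using row by (intro borel_measurable_sum borel_measurable_times comm_step_measurable history_Suc)
        (simp_all add: borel_measurable_vec_iff)
    then have "(\<lambda>\<omega>. comm_row j t \<omega> v* A \<omega> k) \<in> borel_measurable (generated ?H)"
      by (simp add: borel_measurable_vec_iff)
    then show ?thesis
      unfolding f_def
      by (intro borel_measurable_times g borel_measurable_power measurable_compose[OF _ borel_measurable_norm])
  qed
  have "(\<integral>\<^sup>+\<omega>. ennreal (batch_grad_sq j \<omega> * (norm (comm_row j (Suc t) \<omega>))\<^sup>2) \<partial>P)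
      = (\<integral>\<^sup>+\<omega>. ennreal (f (act (Suc t) \<omega>) \<omega>) \<partial>P)"
    using step.hyps by (simp add: comm_row_Suc \<Delta>_eq_comm_step f_def A_def)
  also have "\<dots> = (\<integral>\<^sup>+\<omega>. (\<Sum>k\<in>UNIV. ennreal (p k) * ennreal (f k \<omega>)) \<partial>P)"
    by (rule nn_integral_at_act) (intro measurable_compose[OF f measurable_ennreal])
  also have "\<dots> \<le> (\<integral>\<^sup>+\<omega>. ennreal (contraction_rate CARD('n)) * ennreal (batch_grad_sq j \<omega> * (norm (comm_row j t \<omega>))\<^sup>2) \<partial>P)"
  proof (rule nn_integral_mono)
    fix \<omega>
    \<comment> \<open>For a fixed outcome \<open>comm_clients (Suc t) \<omega>\<close> is one fixed
      set, so the contraction uniform in \<open>S\<close> applies pointwise.\<close>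
    have "(\<Sum>k\<in>UNIV. p k * f k \<omega>)
        = batch_grad_sq j \<omega> * (\<Sum>k\<in>UNIV. p k * (norm (comm_row j t \<omega> v* A \<omega> k))\<^sup>2)"
      by (simp add: f_def sum_distrib_left mult.left_commute)
    also have "\<dots> \<le> batch_grad_sq j \<omega> * (contraction_rate CARD('n) * (norm (comm_row j t \<omega>))\<^sup>2)"
      unfolding A_def by (intro mult_left_mono expected_norm_comm_step_le scores guarantee g0)
    also have "\<dots> = contraction_rate CARD('n) * (batch_grad_sq j \<omega> * (norm (comm_row j t \<omega>))\<^sup>2)" by simp
    finally show "(\<Sum>k\<in>UNIV. ennreal (p k) * ennreal (f k \<omega>))
        \<le> ennreal (contraction_rate CARD('n)) * ennreal (batch_grad_sq j \<omega> * (norm (comm_row j t \<omega>))\<^sup>2)"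
      using p_nonneg f0 rate_bounds g0 by (simp add: ennreal_mult[symmetric] sum_ennreal ennreal_leI)
  qed
  also have "\<dots> = ennreal (contraction_rate CARD('n)) * (\<integral>\<^sup>+\<omega>. ennreal (batch_grad_sq j \<omega> * (norm (comm_row j t \<omega>))\<^sup>2) \<partial>P)"
    by (intro nn_integral_cmult measurable_compose[OF _ measurable_ennreal]
        measurable_from_generated[OF _ draws_subsets(1)[of "Suc t"]] borel_measurable_times g
        borel_measurable_power measurable_compose[OF row borel_measurable_norm])
  also have "\<dots> \<le> ennreal (contraction_rate CARD('n)) * (ennreal (contraction_rate CARD('n) ^ (t - j)) * (\<integral>\<^sup>+\<omega>. ennreal (batch_grad_sq j \<omega>) \<partial>P))"
    by (intro mult_left_mono step.IH) simp
  also have "\<dots> = ennreal (contraction_rate CARD('n) ^ (Suc t - j)) * (\<integral>\<^sup>+\<omega>. ennreal (batch_grad_sq j \<omega>) \<partial>P)"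
    using rate_bounds step.hyps by (simp add: Suc_diff_le ennreal_mult mult.assoc)
  finally show ?case .
qed

text \<open>The model is frozen: it depends only on draws before iteration \<open>j\<close>, which are independent of the
  samples of iteration \<open>j\<close>.\<close>

lemma batch_grad_sq_le:
  "(\<integral>\<^sup>+\<omega>. ennreal (batch_grad_sq j \<omega>) \<partial>P)
    \<le> 2 * ennreal (\<sigma>\<^sup>2 / real M) + 2 * (\<integral>\<^sup>+\<omega>. ennreal (true_grad_sq j \<omega>) \<partial>P)"
proof -
  define x where "x k \<omega> = column k (X \<omega> j)" for k \<omega>
  define V where "V k \<omega> \<omega>' =
    ennreal ((norm (batch_grad l M (\<lambda>m. smp k j m \<omega>') (x k \<omega>) - loc_grad k (x k \<omega>)))\<^sup>2)" for k \<omega> \<omega>'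
  \<comment> \<open>The history is enlarged by \<open>act j\<close> so that the identity of the
    active client is frozen together with the model.\<close>
  let ?F = "generated (insert (Inl j) (history j))"
  have x: "x k \<in> borel_measurable ?F" for k
    unfolding x_def by (rule measurable_generated_mono[OF column_X_measurable]) auto
  have V: "(\<lambda>z. V k (fst z) (snd z)) \<in> borel_measurable (?F \<Otimes>\<^sub>M generated (batch k j))" for k
  proof -
    have x': "(\<lambda>z. x k (fst z)) \<in> borel_measurable (?F \<Otimes>\<^sub>M generated (batch k j))"
      by (rule measurable_compose[OF measurable_fst x])
    have s: "(\<lambda>z. smp k j m (snd z)) \<in> measurable (?F \<Otimes>\<^sub>M generated (batch k j)) (D k)" if "m \<in> {1..M}" for m
      by (rule measurable_compose[OF measurable_snd smp_measurable_generated]) (use that in \<open>auto simp: batch_def\<close>)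
    show ?thesis
      unfolding V_def batch_grad_def
      by (intro measurable_compose[OF _ measurable_ennreal] borel_measurable_power
          measurable_compose[OF _ borel_measurable_norm] borel_measurable_diff borel_measurable_scaleR
          borel_measurable_const borel_measurable_sum smp_grad_compose_measurable[where k=k] x' s
          measurable_compose[OF x' loc_grad_measurable])
  qed
  have Vd: "(\<lambda>\<omega>. V k \<omega> \<omega>) \<in> borel_measurable P" for k
  proof (rule measurable_from_generated[OF _ draws_subsets(1)])
    show "(\<lambda>\<omega>. V k \<omega> \<omega>) \<in> borel_measurable (generated (history (Suc j)))"
      unfolding V_def x_def
      by (intro measurable_compose[OF _ measurable_ennreal] borel_measurable_power
          measurable_compose[OF _ borel_measurable_norm] borel_measurable_diff
          batch_grad_measurable history_Suc measurable_compose[OF _ loc_grad_measurable]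
          measurable_generated_mono[OF column_X_measurable history_Suc(1)])
  qed
  have actP [measurable]: "act j \<in> measurable P (count_space UNIV)"
    by (rule measurable_from_generated[OF act_measurable_generated draws_subsets(4)]) simp
  have actF [measurable]: "act j \<in> measurable ?F (count_space UNIV)"
    by (rule act_measurable_generated) simp
  have freeze: "(\<integral>\<^sup>+\<omega>. (if act j \<omega> = k then V k \<omega> \<omega> else 0) \<partial>P) \<le> ennreal (p k) * ennreal (\<sigma>\<^sup>2 / real M)" for k
  proof -
    have h: "(\<lambda>z. if act j (fst z) = k then V k (fst z) (snd z) else 0)
        \<in> borel_measurable (?F \<Otimes>\<^sub>M generated (batch k j))"
      using V[of k, measurable] by measurable
    have "indep_set (sets ?F) (sets (generated (batch k j)))"
      by (rule indep_generated[OF draws_subsets(2,3)]) (auto simp: history_def batch_def)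
    from nn_integral_diagonal_indep[OF space_generated sets_generated_subset[OF draws_subsets(2)]
        space_generated sets_generated_subset[OF draws_subsets(3)] this h]
    have "(\<integral>\<^sup>+\<omega>. (if act j \<omega> = k then V k \<omega> \<omega> else 0) \<partial>P)
        = (\<integral>\<^sup>+\<omega>. (\<integral>\<^sup>+\<omega>'. (if act j \<omega> = k then V k \<omega> \<omega>' else 0) \<partial>P) \<partial>P)"
      unfolding fst_conv snd_conv .
    \<comment> \<open>With the outer outcome fixed the model is a constant, which is the situation
      of \<open>batch_grad_variance\<close>.\<close>
    also have "\<dots> \<le> (\<integral>\<^sup>+\<omega>. (if act j \<omega> = k then ennreal (\<sigma>\<^sup>2 / real M) else 0) \<partial>P)"
      using batch_grad_variance by (intro nn_integral_mono) (simp add: V_def)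
    finally show ?thesis by (simp add: nn_integral_act)
  qed
  have "(\<integral>\<^sup>+\<omega>. V (act j \<omega>) \<omega> \<omega> \<partial>P) = (\<integral>\<^sup>+\<omega>. (\<Sum>k\<in>UNIV. if act j \<omega> = k then V k \<omega> \<omega> else 0) \<partial>P)"
    by simp
  also have "\<dots> = (\<Sum>k\<in>UNIV. \<integral>\<^sup>+\<omega>. (if act j \<omega> = k then V k \<omega> \<omega> else 0) \<partial>P)"
    using Vd[measurable] by (intro nn_integral_sum) measurable
  also have "\<dots> \<le> (\<Sum>k\<in>UNIV. ennreal (p k) * ennreal (\<sigma>\<^sup>2 / real M))"
    by (intro sum_mono freeze)
  also have "\<dots> = ennreal (\<sigma>\<^sup>2 / real M)"
    using p_nonneg by (simp add: sum_distrib_right[symmetric] sum_ennreal sum_p)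
  finally have noise: "(\<integral>\<^sup>+\<omega>. V (act j \<omega>) \<omega> \<omega> \<partial>P) \<le> ennreal (\<sigma>\<^sup>2 / real M)" .
  have Va: "(\<lambda>\<omega>. V (act j \<omega>) \<omega> \<omega>) \<in> borel_measurable P"
    by (rule measurable_compose_countable'[where I=UNIV]) (auto intro: Vd actP countable_finite)
  have true: "(\<lambda>\<omega>. ennreal (true_grad_sq j \<omega>)) \<in> borel_measurable P"
    by (intro measurable_compose[OF _ measurable_ennreal]
        measurable_from_generated[OF true_grad_sq_measurable draws_subsets(1)])
  have "(\<integral>\<^sup>+\<omega>. ennreal (batch_grad_sq j \<omega>) \<partial>P)
      \<le> (\<integral>\<^sup>+\<omega>. 2 * V (act j \<omega>) \<omega> \<omega> + 2 * ennreal (true_grad_sq j \<omega>) \<partial>P)"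
  proof (rule nn_integral_mono)
    fix \<omega>
    \<comment> \<open>No cross term remains to be integrated; the price is the factor 2 in both
      terms.\<close>
    have sq: "(norm a)\<^sup>2 \<le> 2 * (norm (a - b))\<^sup>2 + 2 * (norm b)\<^sup>2" for a b :: "real^'d"
    proof -
      have "norm a \<le> norm (a - b) + norm b" using norm_triangle_ineq[of "a - b" b] by simp
      then have "(norm a)\<^sup>2 \<le> (norm (a - b) + norm b)\<^sup>2" by (intro power_mono) auto
      also have "\<dots> \<le> 2 * (norm (a - b))\<^sup>2 + 2 * (norm b)\<^sup>2"
        using sum_squares_bound[of "norm (a - b)" "norm b"] by (simp add: power2_sum)
      finally show ?thesis .
    qed
    have "ennreal (batch_grad_sq j \<omega>)
        \<le> ennreal (2 * (norm (batch_grad l M (\<lambda>m. smp (act j \<omega>) j m \<omega>) (x (act j \<omega>) \<omega>)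
            - loc_grad (act j \<omega>) (x (act j \<omega>) \<omega>)))\<^sup>2 + 2 * true_grad_sq j \<omega>)"
      unfolding batch_grad_sq_def true_grad_sq_def x_def by (intro ennreal_leI sq)
    also have "\<dots> = 2 * V (act j \<omega>) \<omega> \<omega> + 2 * ennreal (true_grad_sq j \<omega>)"
      by (simp add: V_def true_grad_sq_def ennreal_plus ennreal_mult)
    finally show "ennreal (batch_grad_sq j \<omega>) \<le> 2 * V (act j \<omega>) \<omega> \<omega> + 2 * ennreal (true_grad_sq j \<omega>)" .
  qed
  also have "\<dots> = 2 * (\<integral>\<^sup>+\<omega>. V (act j \<omega>) \<omega> \<omega> \<partial>P) + 2 * (\<integral>\<^sup>+\<omega>. ennreal (true_grad_sq j \<omega>) \<partial>P)"
    using Va true by (subst nn_integral_add) (auto simp: nn_integral_cmult)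
  also have "\<dots> \<le> 2 * ennreal (\<sigma>\<^sup>2 / real M) + 2 * (\<integral>\<^sup>+\<omega>. ennreal (true_grad_sq j \<omega>) \<partial>P)"
    by (intro add_right_mono mult_left_mono noise) simp
  finally show ?thesis .
qed

section \<open>Pathwise bound of a summand and summation over the iterations\<close>

lemma norm_grad_mat_comm_le:
  assumes "norm u \<le> 1"
  shows "(norm ((grad_mat l M (\<lambda>q. act q \<omega>) (\<lambda>k q m. smp k q m \<omega>) j (X \<omega> j) ** ordered_prod (\<Delta> \<omega>) j t) *v u))\<^sup>2
    \<le> batch_grad_sq j \<omega> * (norm (comm_row j t \<omega>))\<^sup>2"
proof -
  let ?g = "batch_grad l M (\<lambda>m. smp (act j \<omega>) j m \<omega>) (column (act j \<omega>) (X \<omega> j))"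
  let ?y = "ordered_prod (\<Delta> \<omega>) j t *v u"
  have y: "?y $ act j \<omega> = inner (comm_row j t \<omega>) u"
    by (simp add: comm_row_def dot_lmul_matrix inner_axis')
  \<comment> \<open>Only the column of the active client is nonzero, so the product with a vector is
    that vector's active coordinate times the batch gradient.\<close>
  have "grad_mat l M (\<lambda>q. act q \<omega>) (\<lambda>k q m. smp k q m \<omega>) j (X \<omega> j) *v ?y = (?y $ act j \<omega>) *\<^sub>R ?g"
    unfolding vec_eq_iff grad_mat_def
    by (simp add: matrix_vector_mult_def[of "vec_lambda _"] mult_delta_left)
  then have "norm ((grad_mat l M (\<lambda>q. act q \<omega>) (\<lambda>k q m. smp k q m \<omega>) j (X \<omega> j) ** ordered_prod (\<Delta> \<omega>) j t) *v u)
      = \<bar>inner (comm_row j t \<omega>) u\<bar> * norm ?g"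
    by (simp add: matrix_vector_mul_assoc[symmetric] y)
  also have "\<dots> \<le> norm (comm_row j t \<omega>) * norm ?g"
  proof (rule mult_right_mono)
    have "\<bar>inner (comm_row j t \<omega>) u\<bar> \<le> norm (comm_row j t \<omega>) * norm u" by (rule Cauchy_Schwarz_ineq2)
    also have "\<dots> \<le> norm (comm_row j t \<omega>)" using assms by (simp add: mult_left_le)
    finally show "\<bar>inner (comm_row j t \<omega>) u\<bar> \<le> norm (comm_row j t \<omega>)" .
  qed simp
  finally have "(norm ((grad_mat l M (\<lambda>q. act q \<omega>) (\<lambda>k q m. smp k q m \<omega>) j (X \<omega> j) ** ordered_prod (\<Delta> \<omega>) j t) *v u))\<^sup>2
      \<le> (norm (comm_row j t \<omega>) * norm ?g)\<^sup>2"
    by (intro power_mono) auto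
  then show ?thesis by (simp add: batch_grad_sq_def power_mult_distrib mult.commute)
qed

text \<open>The noise level is the same for every \<open>j\<close>, so its geometric weights sum to
  at most \<open>1 / (1 - contraction_rate CARD('n))\<close>, independently of \<open>t\<close>. The
  gradient terms differ with \<open>j\<close> and remain inside the sum.\<close>

lemma comm_product_bound:
  assumes u: "norm u \<le> 1"
  shows "(\<integral>\<^sup>+\<omega>. ennreal (\<Sum>j=0..t.
      (norm ((grad_mat l M (\<lambda>q. act q \<omega>) (\<lambda>k q m. smp k q m \<omega>) j (X \<omega> j) ** ordered_prod (\<Delta> \<omega>) j t) *v u))\<^sup>2) \<partial>P)
    \<le> ennreal (2 / (1 - contraction_rate CARD('n))) * (ennreal (\<sigma>\<^sup>2 / real M) + (\<integral>\<^sup>+\<omega>. ennreal (\<Sum>j=0..t. true_grad_sq j \<omega>) \<partial>P))"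
proof -
  define N where "N j = (\<integral>\<^sup>+\<omega>. ennreal (true_grad_sq j \<omega>) \<partial>P)" for j
  define S where "S = ennreal (\<sigma>\<^sup>2 / real M)"
  define C where "C = 2 / (1 - contraction_rate CARD('n))"
  have C2: "2 \<le> C" using rate_bounds by (simp add: C_def field_simps)
  have g0: "0 \<le> batch_grad_sq j \<omega>" and t0: "0 \<le> true_grad_sq j \<omega>" for j \<omega>
    by (simp_all add: batch_grad_sq_def true_grad_sq_def)
  have "(\<integral>\<^sup>+\<omega>. ennreal (\<Sum>j=0..t.
      (norm ((grad_mat l M (\<lambda>q. act q \<omega>) (\<lambda>k q m. smp k q m \<omega>) j (X \<omega> j) ** ordered_prod (\<Delta> \<omega>) j t) *v u))\<^sup>2) \<partial>P)
    \<le> (\<integral>\<^sup>+\<omega>. (\<Sum>j=0..t. ennreal (batch_grad_sq j \<omega> * (norm (comm_row j t \<omega>))\<^sup>2)) \<partial>P)"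
    by (intro nn_integral_mono)
      (auto simp: sum_ennreal g0 intro!: ennreal_leI sum_mono norm_grad_mat_comm_le[OF u])
  also have "\<dots> = (\<Sum>j=0..t. \<integral>\<^sup>+\<omega>. ennreal (batch_grad_sq j \<omega> * (norm (comm_row j t \<omega>))\<^sup>2) \<partial>P)"
  proof (rule nn_integral_sum)
    fix j assume "j \<in> {0..t}"
    then show "(\<lambda>\<omega>. ennreal (batch_grad_sq j \<omega> * (norm (comm_row j t \<omega>))\<^sup>2)) \<in> borel_measurable P"
      by (intro measurable_compose[OF _ measurable_ennreal] borel_measurable_times borel_measurable_power
          measurable_compose[OF _ borel_measurable_norm]
          measurable_from_generated[OF comm_row_measurable draws_subsets(1)]
          measurable_from_generated[OF batch_grad_sq_measurable draws_subsets(1)]) simp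
  qed
  also have "\<dots> \<le> (\<Sum>j=0..t. ennreal (2 * contraction_rate CARD('n) ^ (t - j)) * S + ennreal C * N j)"
  proof (rule sum_mono)
    fix j assume "j \<in> {0..t}"
    then have "(\<integral>\<^sup>+\<omega>. ennreal (batch_grad_sq j \<omega> * (norm (comm_row j t \<omega>))\<^sup>2) \<partial>P)
        \<le> ennreal (contraction_rate CARD('n) ^ (t - j)) * (\<integral>\<^sup>+\<omega>. ennreal (batch_grad_sq j \<omega>) \<partial>P)"
      by (intro comm_row_contraction) simp
    also have "\<dots> \<le> ennreal (contraction_rate CARD('n) ^ (t - j)) * (2 * S + 2 * N j)"
      unfolding S_def N_def by (intro mult_left_mono batch_grad_sq_le) simp
    also have "\<dots> = ennreal (2 * contraction_rate CARD('n) ^ (t - j)) * S + ennreal (2 * contraction_rate CARD('n) ^ (t - j)) * N j"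
      using rate_bounds by (simp add: distrib_left ennreal_mult mult.assoc mult.left_commute)
    \<comment> \<open>On the gradient terms the decay is given up: a weight of at most 2 is enough,
      since \<open>2 \<le> C\<close>.\<close>
    also have "\<dots> \<le> ennreal (2 * contraction_rate CARD('n) ^ (t - j)) * S + ennreal C * N j"
    proof (intro add_left_mono mult_right_mono ennreal_leI)
      have "contraction_rate CARD('n) ^ (t - j) \<le> 1" using rate_bounds by (intro power_le_one) auto
      then show "2 * contraction_rate CARD('n) ^ (t - j) \<le> C" using C2 by linarith
    qed simp
    finally show "(\<integral>\<^sup>+\<omega>. ennreal (batch_grad_sq j \<omega> * (norm (comm_row j t \<omega>))\<^sup>2) \<partial>P)
        \<le> ennreal (2 * contraction_rate CARD('n) ^ (t - j)) * S + ennreal C * N j" .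
  qed
  also have "\<dots> = ennreal (2 * (\<Sum>j=0..t. contraction_rate CARD('n) ^ (t - j))) * S + ennreal C * (\<Sum>j=0..t. N j)"
    using rate_bounds
    by (simp add: sum.distrib sum_distrib_right[symmetric] sum_distrib_left[symmetric] sum_ennreal)
  also have "\<dots> \<le> ennreal C * S + ennreal C * (\<Sum>j=0..t. N j)"
    using sum_geometric_le[OF rate_bounds, of t]
    by (intro add_right_mono mult_right_mono ennreal_leI) (simp_all add: C_def)
  also have "(\<Sum>j=0..t. N j) = (\<integral>\<^sup>+\<omega>. ennreal (\<Sum>j=0..t. true_grad_sq j \<omega>) \<partial>P)"
    unfolding N_def
    by (subst nn_integral_sum[symmetric])
      (auto simp: sum_ennreal t0 intro!: measurable_compose[OF _ measurable_ennreal]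
        measurable_from_generated[OF true_grad_sq_measurable draws_subsets(1)])
  finally show ?thesis by (simp add: C_def S_def distrib_left)
qed

end

section \<open>The bound with a constant depending only on the number of clients\<close>

theorem lemma1:
  assumes "CARD('n::finite) \<ge> 2"
  shows "\<exists>C\<ge>0. \<forall>(p :: 'n \<Rightarrow> real) (E :: nat \<Rightarrow> ('n \<times> 'n) set) (B::nat)
      (D :: 'n \<Rightarrow> 'b measure) (l :: real^'d::finite \<Rightarrow> 'b \<Rightarrow> real) (L::real) (\<sigma>::real) (\<zeta>::real)
      (P :: 'w measure) (act :: nat \<Rightarrow> 'w \<Rightarrow> 'n) (smp :: 'n \<Rightarrow> nat \<Rightarrow> nat \<Rightarrow> 'w \<Rightarrow> 'b)
      (M::nat) (\<gamma>::real) (x0 :: real^'d) (s::nat) (T::nat) (t::nat) (i::'n).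
      let w = (\<lambda>q. ccs p (E q));
          a = (\<lambda>\<omega> q. act q \<omega>);
          X = (\<lambda>\<omega>. models l M \<gamma> x0 s T w (a \<omega>) (\<lambda>k q m. smp k q m \<omega>));
          G = (\<lambda>\<omega> j. grad_mat l M (a \<omega>) (\<lambda>k q m. smp k q m \<omega>) j (X \<omega> j));
          \<Delta> = (\<lambda>\<omega> q. comm_mat s T w (a \<omega>) q - expected_comm p (w q))
      in
      scores p \<longrightarrow>
      (\<forall>q. sym (E q) \<and> irrefl (E q)) \<longrightarrow>
      uniformly_strongly_connected B E \<longrightarrow>
      (\<forall>q. ccs_guarantee p (w q)) \<longrightarrow>
      standing_assumptions p D l L \<sigma> \<zeta> \<longrightarrow>
      M > 0 \<longrightarrow> \<gamma> > 0 \<longrightarrow>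
      swift_sampling P p D M act smp \<longrightarrow>
      t < T \<longrightarrow>
      (\<integral>\<^sup>+\<omega>. ennreal (\<Sum>j=0..t.
          (norm ((G \<omega> j ** ordered_prod (\<Delta> \<omega>) j t)
                 *v ((1 / real CARD('n)) *\<^sub>R (\<chi> k. 1) - axis i 1)))\<^sup>2) \<partial>P)
      \<le> ennreal C * (ennreal (\<sigma>\<^sup>2 / real M) +
          (\<integral>\<^sup>+\<omega>. ennreal (\<Sum>j=0..t.
             (norm (grad (local_obj D l (act j \<omega>)) (column (act j \<omega>) (X \<omega> j))))\<^sup>2) \<partial>P))"
proof -
  \<comment> \<open>The 2 comes from splitting the batch gradient into noise and mean, the
    denominator from the geometric series.\<close>
  define C where "C = 2 / (1 - contraction_rate CARD('n))"
  have u: "norm ((1 / real CARD('n)) *\<^sub>R (\<chi> k. 1) - axis i 1 :: real^'n) \<le> 1" for i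
  proof -
    let ?n = "real CARD('n)"
    have n: "?n \<ge> 1" by (simp add: Suc_leI)
    have "(norm ((1 / ?n) *\<^sub>R (\<chi> k. 1) - axis i 1 :: real^'n))\<^sup>2
        = (\<Sum>k\<in>UNIV. (1 / ?n - (if k = i then 1 else 0))\<^sup>2)"
      unfolding norm_vec_def L2_set_def
      by (subst real_sqrt_pow2) (auto intro!: sum_nonneg sum.cong simp: axis_def)
    \<comment> \<open>Each coordinate contributes \<open>(1 / ?n)\<^sup>2\<close>; the exceptional
      coordinate \<open>i\<close> adds the excess \<open>1 - 2 / ?n\<close>.\<close>
    also have "\<dots> = (\<Sum>k\<in>UNIV. (1 / ?n)\<^sup>2 + (if k = i then 1 - 2 / ?n else 0))"
      by (intro sum.cong) (auto simp: power2_eq_square algebra_simps)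
    also have "\<dots> = 1 - 1 / ?n"
      unfolding sum.distrib using n by (simp add: power2_eq_square)
    also have "\<dots> \<le> 1" by simp
    finally show ?thesis by (simp add: power_le_one_iff abs_square_le_1)
  qed
  have "0 \<le> C" unfolding C_def using contraction_rate_bounds[of "CARD('n)"] by (simp add: Suc_leI)
  then show ?thesis
    unfolding Let_def
  proof (intro exI[of _ C] conjI allI impI)
    fix p :: "'n \<Rightarrow> real" and E :: "nat \<Rightarrow> ('n \<times> 'n) set" and D :: "'n \<Rightarrow> 'b measure"
      and l :: "real^'d \<Rightarrow> 'b \<Rightarrow> real" and L \<sigma> \<zeta> :: real
      and P :: "'w measure" and act smp and M :: nat and \<gamma> :: real and x0 :: "real^'d" and s T t :: nat and i :: 'n
    assume "scores p" "\<forall>q. ccs_guarantee p (ccs p (E q))" "standing_assumptions p D l L \<sigma> \<zeta>"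
      "M > 0" "swift_sampling P p D M act smp"
    then interpret swift P p "\<lambda>q. ccs p (E q)" D l L \<sigma> \<zeta> act smp M \<gamma> x0 s T
      by (intro swift.intro swift_axioms.intro) (auto simp: swift_sampling_def)
    show "(\<integral>\<^sup>+\<omega>. ennreal (\<Sum>j=0..t.
          (norm ((grad_mat l M (\<lambda>q. act q \<omega>) (\<lambda>k q m. smp k q m \<omega>) j (X \<omega> j) ** ordered_prod (\<Delta> \<omega>) j t)
                 *v ((1 / real CARD('n)) *\<^sub>R (\<chi> k. 1) - axis i 1)))\<^sup>2) \<partial>P)
      \<le> ennreal C * (ennreal (\<sigma>\<^sup>2 / real M) +
          (\<integral>\<^sup>+\<omega>. ennreal (\<Sum>j=0..t.
             (norm (grad (local_obj D l (act j \<omega>)) (column (act j \<omega>) (X \<omega> j))))\<^sup>2) \<partial>P))"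
      using comm_product_bound[OF u, of t i] by (simp only: C_def true_grad_sq_def)
  qed
qed

end
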